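(* Let $\beta\ge-1/2$ be fixed, and let $(\alpha_n)_{n\ge1}\subset[\beta,\infty[$ be an increasing sequence of parameters (with $\alpha_n>-1/2$) with $\lim_{n\to\infty}n/\alpha_n=0$. Let $\nu$ be a probability measure on $[0,\infty[$ with finite second moment $\int_0^\infty x^2\,d\nu(x)<\infty$ and with $\nu\ne\delta_0$, and for each $n$ let $S_n^{(\alpha_n,\beta)}$ be the $n$-th step of the Jacobi random walk on $[0,\infty[$ of index $(\alpha_n,\beta)$ with law $\nu$. Then $$\frac{S_n^{(\alpha_n,\beta)}-n\,m_1}{\sqrt n}\to N(0,m_2-m_1^2)$$ in distribution for $n\to\infty$, with a normal distribution $N(0,m_2-m_1^2)$ with parameters $$m_1:=\int_0^\infty\ln(\cosh x)\,d\nu(x)<\infty,\qquad m_2:=\int_0^\infty(\ln(\cosh x))^2\,d\nu(x)\in\,]m_1^2,\infty[.$$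
   Context: For $\alpha\ge\beta\ge-1/2$ with $\alpha>-1/2$ let $m_{\alpha,\beta}$ be the probability measure on $[0,1]\times[0,\pi]$ given by $$dm_{\alpha,\beta}(r,\phi)=\frac{2\Gamma(\alpha+1)}{\Gamma(1/2)\Gamma(\alpha-\beta)\Gamma(\beta+1/2)}(1-r^2)^{\alpha-\beta-1}(r\sin\phi)^{2\beta}\,r\,dr\,d\phi\quad(\alpha>\beta>-1/2),$$ $$dm_{\alpha,-1/2}(r,\phi)=\frac{2\Gamma(\alpha+1)}{\Gamma(1/2)\Gamma(\alpha+1/2)}(1-r^2)^{\alpha-1/2}\,dr\cdot\tfrac12\,d(\delta_0+\delta_\pi)(\phi)\quad(\alpha>\beta=-1/2),$$ $$dm_{\alpha,\alpha}(r,\phi)=\frac{\Gamma(\alpha+1)}{\Gamma(1/2)\Gamma(\alpha+1/2)}\sin^{2\alpha}\phi\,d\phi\cdot d\delta_1(r)\quad(\alpha=\beta>-1/2).$$ The Jacobi convolution $*_{(\alpha,\beta)}$ of point measures on $[0,\infty[$ is $$(\delta_s*_{(\alpha,\beta)}\delta_t)(f)=\int_0^1\int_0^\pi f\bigl(\operatorname{arcosh}|\cosh s\cosh t+re^{i\phi}\sinh s\sinh t|\bigr)\,dm_{\alpha,\beta}(r,\phi),\quad f\in C_b([0,\infty[),$$ extended bilinearly and weakly continuously to bounded measures on $[0,\infty[$. The Jacobi random walk of index $(\alpha,\beta)$ with law $\nu$ is the time-homogeneous Markov chain $(S_n^{(\alpha,\beta)})_{n\ge0}$ on $[0,\infty[$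 started at $0$ with $P(S_{n+1}^{(\alpha,\beta)}\in A\mid S_n^{(\alpha,\beta)}=x)=(\delta_x*_{(\alpha,\beta)}\nu)(A)$ for $x\ge0$ and Borel sets $A\subset[0,\infty[$. $N(0,\sigma^2)$ is the normal distribution with mean $0$ and variance $\sigma^2$.
   Formalization: The claim m_2 > m_1^2 fails for ν = δ_c with c > 0 (there m_2 = m_1^2); the formal statement proves m_1^2 ≤ m_2, with strict inequality when ν is not a point measure, and reads N(0,0) as δ_0. *)

theory Defs
  imports "HOL-Probability.Probability"
begin

text \<open>
  Measures on \<open>[0, \<infinity>[\<close> are represented as Borel measures on \<^typ>\<open>real\<close> that are concentrated
  on \<open>{0..}\<close>; similarly, \<open>jacobi_m\<close> is a Borel measure on the plane that is concentrated on
  \<open>{0..1} \<times> {0..pi}\<close>. The points where \<open>0 powr x = 0\<close> deviates from the usual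
  conventions form null sets. The parameters satisfy \<open>\<alpha> \<ge> \<beta> \<ge> -1/2\<close> and \<open>\<alpha> > -1/2\<close>.
\<close>

definition jacobi_m :: "real \<Rightarrow> real \<Rightarrow> (real \<times> real) measure" where
  "jacobi_m \<alpha> \<beta> =
    (if \<beta> = -1/2 then
       density lborel (\<lambda>r. ennreal (indicator {0..1} r *
           (2 * Gamma (\<alpha> + 1) / (Gamma (1/2) * Gamma (\<alpha> + 1/2)) * (1 - r\<^sup>2) powr (\<alpha> - 1/2))))
       \<Otimes>\<^sub>M distr (uniform_count_measure {0, pi}) borel (\<lambda>\<phi>. \<phi>)
     else if \<alpha> = \<beta> then
       return borel 1
       \<Otimes>\<^sub>M density lborel (\<lambda>\<phi>. ennreal (indicator {0..pi} \<phi> *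
           (Gamma (\<alpha> + 1) / (Gamma (1/2) * Gamma (\<alpha> + 1/2)) * sin \<phi> powr (2 * \<alpha>))))
     else
       density (lborel \<Otimes>\<^sub>M lborel) (\<lambda>(r, \<phi>). ennreal (indicator {0..1} r * indicator {0..pi} \<phi> *
           (2 * Gamma (\<alpha> + 1) / (Gamma (1/2) * Gamma (\<alpha> - \<beta>) * Gamma (\<beta> + 1/2)) *
            (1 - r\<^sup>2) powr (\<alpha> - \<beta> - 1) * (r * sin \<phi>) powr (2 * \<beta>) * r))))"

text \<open>The convolution of the point measures at \<open>s\<close> and \<open>t\<close>, as an image measure.\<close>

definition jacobi_conv_point :: "real \<Rightarrow> real \<Rightarrow> real \<Rightarrow> real \<Rightarrow> real measure" where
  "jacobi_conv_point \<alpha> \<beta> s t =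
    distr (jacobi_m \<alpha> \<beta>) borel
      (\<lambda>(r, \<phi>). arcosh (cmod (complex_of_real (cosh s * cosh t) +
         complex_of_real r * exp (\<i> * complex_of_real \<phi>) * complex_of_real (sinh s * sinh t))))"

text \<open>The bilinear, weakly continuous extension, for probability measures: the \<open>\<mu> \<Otimes> \<nu>\<close>-mixture
  of the convolutions of point measures.\<close>

definition jacobi_conv :: "real \<Rightarrow> real \<Rightarrow> real measure \<Rightarrow> real measure \<Rightarrow> real measure" where
  "jacobi_conv \<alpha> \<beta> \<mu> \<nu> = bind \<mu> (\<lambda>s. bind \<nu> (\<lambda>t. jacobi_conv_point \<alpha> \<beta> s t))"

definition past_sigma :: "'a measure \<Rightarrow> (nat \<Rightarrow> 'a \<Rightarrow> real) \<Rightarrow> nat \<Rightarrow> 'a measure" where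
  "past_sigma M S n = sigma (space M) {S i -` A \<inter> space M | i A. i \<le> n \<and> A \<in> sets borel}"

text \<open>The last conjunct combines the Markov property with the transition law: the conditional
  probability of \<open>S\<^sub>n\<^sub>+\<^sub>1 \<in> A\<close> given \<open>S\<^sub>0, \<dots>, S\<^sub>n\<close> is \<open>(\<delta>\<^sub>x * \<nu>)(A)\<close> at \<open>x = S\<^sub>n\<close>.\<close>

definition jacobi_random_walk ::
    "real \<Rightarrow> real \<Rightarrow> real measure \<Rightarrow> 'a measure \<Rightarrow> (nat \<Rightarrow> 'a \<Rightarrow> real) \<Rightarrow> bool" where
  "jacobi_random_walk \<alpha> \<beta> \<nu> M S \<longleftrightarrow>
     prob_space M \<and>
     (\<forall>n. S n \<in> M \<rightarrow>\<^sub>M restrict_space borel {0..}) \<and>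
     (AE \<omega> in M. S 0 \<omega> = 0) \<and>
     (\<forall>n. \<forall>A\<in>sets borel. A \<subseteq> {0..} \<longrightarrow>
        (AE \<omega> in M. real_cond_exp M (past_sigma M S n) (\<lambda>\<omega>'. indicator A (S (Suc n) \<omega>')) \<omega> =
           measure (jacobi_conv \<alpha> \<beta> (return borel (S n \<omega>)) \<nu>) A))"

text \<open>The normal distribution with mean \<open>\<mu>\<close> and variance \<open>v \<ge> 0\<close>. The library's
  \<^const>\<open>normal_density\<close> takes the standard deviation and is identically \<open>0\<close> when that is \<open>0\<close>,
  so the degenerate case is the point measure.\<close>

definition normal_law :: "real \<Rightarrow> real \<Rightarrow> real measure" where
  "normal_law \<mu> v =
     (if v = 0 then return borel \<mu> else density lborel (\<lambda>x. ennreal (normal_density \<mu> (sqrt v) x)))"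

end

theory Submission
  imports Defs
begin

text \<open>
  In the coordinate \<open>ln (cosh x)\<close> the Jacobi random walk is almost an ordinary random walk. From
  the formula for the convolution, a step from \<open>s\<close> with jump size \<open>t\<close> leads to a point \<open>y\<close> with
    \<open>ln (cosh y) = ln (cosh s) + ln (cosh t) + ln (cmod (1 + z))\<close>, where
  \<open>z = r * exp (\<i> * \<phi>) * (tanh s * tanh t)\<close> satisfies \<open>cmod z \<le> r\<close>. The radius \<open>r\<close> is independent of \<open>s\<close> and \<open>t\<close>, and
  for large \<open>\<alpha>\<close> it is small: \<open>1 - r\<^sup>2\<close> has a beta distribution, so that the second moment
  of \<open>r\<close> is \<open>(\<beta> + 1) / (\<alpha> + 1)\<close> (lemma \<open>jacobi_radial_square\<close>). The sum of \<open>n\<close> perturbations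
  is therefore of order \<open>n / sqrt \<alpha>\<close>, and after division by \<open>sqrt n\<close> it is of order
  \<open>sqrt (n / \<alpha>)\<close>. This is exactly what the hypothesis on \<open>n / \<alpha> n\<close> makes negligible.

  The argument is carried out with characteristic functions, which avoids the construction of a
  coupling. Only the laws of the single positions matter, and the Markov property says that they
  evolve under one kernel (\<open>random_walk_Suc\<close>). One step of this kernel multiplies the
  characteristic function of \<open>ln (cosh S)\<close> by that of \<open>ln (cosh X)\<close>, \<open>X\<close> with law \<open>\<nu>\<close>, up to an
  error that is uniform in the current position (\<open>char_step_error\<close>). Such errors add up linearly in
  the number of steps (\<open>random_walk_char_error\<close>). What remains is the classical limit theorem for
  independent copies of \<open>ln (cosh X)\<close>, in the form \<open>char_power_tendsto\<close>, the estimate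
  \<open>\<bar>x\<bar> - ln 2 \<le> ln (cosh x) \<le> \<bar>x\<bar>\<close> for the return to the original coordinate, and Levy's continuity
  theorem.
\<close>

section \<open>Beta integrals and the law of the radius\<close>

lemma square_powr_times:
  "r > 0 \<Longrightarrow> r\<^sup>2 powr c * r = r powr (2 * c + 1)" for r c :: real
  using powr_powr[of r 2 c] by (simp add: powr_add)

text \<open>
  The substitution \<open>x = r\<^sup>2\<close> turns the beta integral into the radial integral of the
  measures \<open>jacobi_m\<close>.
\<close>

lemma nn_integral_radial_Beta:
  assumes "a > 0" "b > (0::real)"
  shows "(\<integral>\<^sup>+r. ennreal (indicator {0..1} r * ((1 - r\<^sup>2) powr (a - 1) * r powr (2 * b - 1))) \<partial>lborel)
    = ennreal (Beta b a / 2)"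
proof -
  let ?f = "\<lambda>x::real. x powr (b - 1) * (1 - x) powr (a - 1) / 2"
  have "((\<lambda>t. t powr (b - 1) * (1 - t) powr (a - 1) / 2) has_integral Beta b a / 2) {0..1}"
    using has_integral_divide[OF has_integral_Beta_real[OF assms(2,1)], of 2] by simp
  from nn_integral_has_integral_lebesgue[OF _ this]
  have "ennreal (Beta b a / 2) = (\<integral>\<^sup>+x. ennreal (?f x * indicator {0\<^sup>2..1\<^sup>2} x) \<partial>lborel)"
    by (simp add: mult_ac)
  also have "\<dots> = (\<integral>\<^sup>+r. ennreal (?f (r\<^sup>2) * (2 * r) * indicator {0..1} r) \<partial>lborel)"
    by (intro nn_integral_substitution[where g = "\<lambda>x. x ^ 2" and g' = "\<lambda>x. 2 * x"])
       (auto intro!: derivative_eq_intros continuous_intros simp: set_borel_measurable_def)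
  also have "\<dots> = (\<integral>\<^sup>+r. ennreal (indicator {0..1} r *
      ((1 - r\<^sup>2) powr (a - 1) * r powr (2 * b - 1))) \<partial>lborel)"
  proof (intro nn_integral_cong arg_cong[where f = ennreal])
    fix r :: real
    have "r\<^sup>2 powr (b - 1) * r = r powr (2 * b - 1)" if "r > 0"
      using square_powr_times[OF that, of "b - 1"] by (simp add: algebra_simps)
    then show "?f (r\<^sup>2) * (2 * r) * indicator {0..1} r =
        indicator {0..1} r * ((1 - r\<^sup>2) powr (a - 1) * r powr (2 * b - 1))"
      by (cases "r = 0") (auto split: split_indicator)
  qed
  finally show ?thesis by simp
qed

text \<open>
  The substitution \<open>y = - cos \<phi>\<close> leads to an even integrand on \<open>[-1, 1]\<close>, so the radial
  integral applies a second time.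
\<close>

lemma nn_integral_sin_powr:
  assumes "b > (-1/2::real)"
  shows "(\<integral>\<^sup>+\<phi>. ennreal (indicator {0..pi} \<phi> * sin \<phi> powr (2 * b)) \<partial>lborel)
    = ennreal (Beta (1/2) (b + 1/2))"
proof -
  let ?f = "\<lambda>y::real. (1 - y\<^sup>2) powr (b - 1/2)"
  have half: "(\<integral>\<^sup>+y. ennreal (?f y * indicator {0..1} y) \<partial>lborel) = ennreal (Beta (1/2) (b + 1/2) / 2)"
  proof -
    have "(\<integral>\<^sup>+y. ennreal (?f y * indicator {0..1} y) \<partial>lborel) =
       (\<integral>\<^sup>+r. ennreal (indicator {0..1} r * ((1 - r\<^sup>2) powr (b + 1/2 - 1) * r powr (2 * (1/2) - 1))) \<partial>lborel)"
      by (intro nn_integral_cong_AE eventually_mono[OF AE_lborel_singleton[of 0]])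
         (auto split: split_indicator)
    also have "\<dots> = ennreal (Beta (1/2) (b + 1/2) / 2)"
      using assms by (intro nn_integral_radial_Beta) auto
    finally show ?thesis .
  qed
  have "(\<integral>\<^sup>+\<phi>. ennreal (indicator {0..pi} \<phi> * sin \<phi> powr (2 * b)) \<partial>lborel) =
      (\<integral>\<^sup>+\<phi>. ennreal (?f (- cos \<phi>) * sin \<phi> * indicator {0..pi} \<phi>) \<partial>lborel)"
  proof (intro nn_integral_cong_AE eventually_mono[OF eventually_conj[OF AE_lborel_singleton[of 0] AE_lborel_singleton[of pi]]] arg_cong[where f = ennreal])
    fix x :: real assume x: "x \<noteq> 0 \<and> x \<noteq> pi"
    have "sin x powr (2 * b) = (1 - (- cos x)\<^sup>2) powr (b - 1/2) * sin x" if "0 \<le> x" "x \<le> pi"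
    proof -
      have s: "sin x > 0" using that x by (intro sin_gt_zero) auto
      have "(1 - (- cos x)\<^sup>2) powr (b - 1/2) * sin x = (sin x)\<^sup>2 powr (b - 1/2) * sin x"
        by (simp add: sin_squared_eq)
      also have "\<dots> = sin x powr (2 * b)"
        using square_powr_times[OF s, of "b - 1/2"] by simp
      finally show ?thesis by simp
    qed
    then show "indicator {0..pi} x * sin x powr (2 * b) = ?f (- cos x) * sin x * indicator {0..pi} x"
      by (auto split: split_indicator)
  qed
  also have "\<dots> = (\<integral>\<^sup>+y. ennreal (?f y * indicator {- cos 0..- cos pi} y) \<partial>lborel)"
    by (intro nn_integral_substitution[symmetric])
       (auto intro!: derivative_eq_intros continuous_intros simp: set_borel_measurable_def sin_ge_zero)
  also have "\<dots> = (\<integral>\<^sup>+y. ennreal (?f y * indicator {0..1} y) + ennreal (?f y * indicator {-1..0} y) \<partial>lborel)"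
    by (intro nn_integral_cong_AE eventually_mono[OF AE_lborel_singleton[of 0]])
       (auto split: split_indicator)
  also have "\<dots> = (\<integral>\<^sup>+y. ennreal (?f y * indicator {0..1} y) \<partial>lborel) +
      (\<integral>\<^sup>+y. ennreal (?f y * indicator {-1..0} y) \<partial>lborel)"
    by (rule nn_integral_add) auto
  also have "(\<integral>\<^sup>+y. ennreal (?f y * indicator {-1..0} y) \<partial>lborel) = (\<integral>\<^sup>+y. ennreal (?f y * indicator {0..1} y) \<partial>lborel)"
    by (subst nn_integral_real_affine[where c = "-1" and t = 0])
       (auto intro!: nn_integral_cong split: split_indicator)
  finally show ?thesis unfolding half
    using assms by (simp add: Beta_def Gamma_real_nonneg flip: ennreal_plus)
qed

text \<open>
  The marginal law of the radius \<open>r\<close> under \<open>jacobi_m\<close>, in the form that covers both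
  \<open>\<beta> = -1/2\<close> and \<open>\<beta> > -1/2\<close>. Equivalently, \<open>1 - r\<^sup>2\<close> has the beta distribution with parameters
  \<open>\<alpha> - \<beta>\<close> and \<open>\<beta> + 1\<close>.
\<close>
definition jacobi_radial :: "real \<Rightarrow> real \<Rightarrow> real measure" where
  "jacobi_radial \<alpha> \<beta> = density lborel (\<lambda>r. ennreal (2 / Beta (\<beta> + 1) (\<alpha> - \<beta>) *
     (indicator {0..1} r * ((1 - r\<^sup>2) powr (\<alpha> - \<beta> - 1) * r powr (2 * \<beta> + 1)))))"

lemma sets_jacobi_radial [measurable_cong, simp]: "sets (jacobi_radial \<alpha> \<beta>) = sets borel"
  and space_jacobi_radial [simp]: "space (jacobi_radial \<alpha> \<beta>) = UNIV"
  by (simp_all add: jacobi_radial_def)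

lemma AE_jacobi_radial: "AE r in jacobi_radial \<alpha> \<beta>. 0 \<le> r \<and> r \<le> 1"
  unfolding jacobi_radial_def by (subst AE_density) (auto split: split_indicator)

lemma Beta_pos: "a > 0 \<Longrightarrow> b > 0 \<Longrightarrow> Beta a b > (0::real)"
  by (simp add: Beta_def)

text \<open>
  The factor \<open>(1 - r\<^sup>2) ^ k\<close> merely shifts the parameter \<open>\<alpha>\<close>. The case \<open>k = 0\<close> is the
  normalization, and \<open>k = 1\<close> yields the second moment of \<open>r\<close>.
\<close>

lemma nn_integral_jacobi_radial:
  assumes "\<alpha> > \<beta>" "\<beta> > -1"
  shows "(\<integral>\<^sup>+r. ennreal ((1 - r\<^sup>2) ^ k) \<partial>jacobi_radial \<alpha> \<beta>) =
    ennreal (Beta (\<beta> + 1) (\<alpha> - \<beta> + k) / Beta (\<beta> + 1) (\<alpha> - \<beta>))"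
proof -
  let ?B = "Beta (\<beta> + 1) (\<alpha> - \<beta>)"
  have B: "?B > 0" using assms by (intro Beta_pos) auto
  have "(\<integral>\<^sup>+r. ennreal ((1 - r\<^sup>2) ^ k) \<partial>jacobi_radial \<alpha> \<beta>) =
    (\<integral>\<^sup>+r. ennreal (2 / ?B) * ennreal (indicator {0..1} r *
      ((1 - r\<^sup>2) powr (\<alpha> - \<beta> + k - 1) * r powr (2 * (\<beta> + 1) - 1))) \<partial>lborel)"
    unfolding jacobi_radial_def
  proof (subst nn_integral_density, measurable, intro nn_integral_cong_AE
      eventually_mono[OF eventually_conj[OF AE_lborel_singleton[of 1] AE_lborel_singleton[of "-1"]]])
    fix r :: real assume r: "r \<noteq> 1 \<and> r \<noteq> -1"
    have "(1 - r\<^sup>2) powr (\<alpha> - \<beta> - 1) * (1 - r\<^sup>2) ^ k = (1 - r\<^sup>2) powr (\<alpha> - \<beta> + k - 1)"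
      if "0 \<le> r" "r \<le> 1"
    proof -
      have "1 - r\<^sup>2 > 0" using that r by (simp add: abs_square_less_1)
      then have "(1 - r\<^sup>2) powr (\<alpha> - \<beta> - 1) * (1 - r\<^sup>2) ^ k =
          (1 - r\<^sup>2) powr (\<alpha> - \<beta> - 1) * (1 - r\<^sup>2) powr real k"
        by (simp add: powr_realpow)
      also have "\<dots> = (1 - r\<^sup>2) powr (\<alpha> - \<beta> + k - 1)"
        by (simp flip: powr_add add: algebra_simps)
      finally show ?thesis .
    qed
    then have eq: "indicator {0..1} r * ((1 - r\<^sup>2) powr (\<alpha> - \<beta> - 1) * r powr (2 * \<beta> + 1)) * (1 - r\<^sup>2) ^ k =
        indicator {0..1} r * ((1 - r\<^sup>2) powr (\<alpha> - \<beta> + k - 1) * r powr (2 * \<beta> + 1))" (is "?X * ?Y = ?Z")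
      by (cases "r \<in> {0..1}") (auto simp: mult.assoc mult.left_commute mult.commute)
    have "ennreal (2 / ?B * ?X) * ennreal ?Y = ennreal (2 / ?B) * (ennreal ?X * ennreal ?Y)"
      using B by (simp only: ennreal_mult' divide_nonneg_pos zero_le_numeral mult.assoc)
    also have "ennreal ?X * ennreal ?Y = ennreal ?Z"
      unfolding eq[symmetric] by (rule ennreal_mult'[symmetric]) simp
    also have "?Z = indicator {0..1} r *
      ((1 - r\<^sup>2) powr (\<alpha> - \<beta> + k - 1) * r powr (2 * (\<beta> + 1) - 1))"
      by (simp add: add.commute)
    finally show "ennreal (2 / ?B * ?X) * ennreal ?Y =
      ennreal (2 / ?B) * ennreal (indicator {0..1} r *
      ((1 - r\<^sup>2) powr (\<alpha> - \<beta> + k - 1) * r powr (2 * (\<beta> + 1) - 1)))" .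
  qed
  also have "\<dots> = ennreal (2 / ?B) * ennreal (Beta (\<beta> + 1) (\<alpha> - \<beta> + k) / 2)"
    using assms by (subst nn_integral_cmult, measurable, subst nn_integral_radial_Beta) auto
  also have "\<dots> = ennreal (Beta (\<beta> + 1) (\<alpha> - \<beta> + k) / ?B)"
    using B Beta_pos[of "\<beta>+1" "\<alpha> - \<beta> + k"] assms by (simp flip: ennreal_mult)
  finally show ?thesis .
qed

lemma prob_space_jacobi_radial:
  assumes "\<alpha> > \<beta>" "\<beta> > -1"
  shows "prob_space (jacobi_radial \<alpha> \<beta>)"
  using nn_integral_jacobi_radial[OF assms, of 0] Beta_pos[of "\<beta> + 1" "\<alpha> - \<beta>"] assms
  by (intro prob_spaceI) simp

lemma jacobi_radial_square:
  assumes "\<alpha> > \<beta>" "\<beta> > -1"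
  shows "(\<integral>r. r\<^sup>2 \<partial>jacobi_radial \<alpha> \<beta>) = (\<beta> + 1) / (\<alpha> + 1)"
proof -
  interpret prob_space "jacobi_radial \<alpha> \<beta>" by (rule prob_space_jacobi_radial[OF assms])
  have sq: "AE r in jacobi_radial \<alpha> \<beta>. 0 \<le> r\<^sup>2 \<and> r\<^sup>2 \<le> 1"
    using AE_jacobi_radial by eventually_elim (simp add: abs_square_le_1)
  have int: "integrable (jacobi_radial \<alpha> \<beta>) (\<lambda>r. r\<^sup>2)"
    using sq by (intro integrable_const_bound[of _ 1]) (auto elim: eventually_mono)
  have "(\<integral>r. (1 - r\<^sup>2) ^ 1 \<partial>jacobi_radial \<alpha> \<beta>) = Beta (\<beta> + 1) (\<alpha> - \<beta> + 1) / Beta (\<beta> + 1) (\<alpha> - \<beta>)"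
    using nn_integral_jacobi_radial[OF assms, of 1] sq assms
      Beta_pos[of "\<beta> + 1" "\<alpha> - \<beta>"]  Beta_pos[of "\<beta> + 1" "\<alpha> - \<beta> + 1"]
    by (subst integral_eq_nn_integral) (auto elim: eventually_mono)
  also have "\<dots> = (\<alpha> - \<beta>) / (\<alpha> + 1)"
  proof -
    have "\<alpha> - \<beta> \<notin> \<int>\<^sub>\<le>\<^sub>0" using assms by (auto elim!: nonpos_Ints_cases')
    from Beta_plus1_right[OF this, of "\<beta> + 1"]
    have "(\<alpha> + 1) * Beta (\<beta> + 1) (\<alpha> - \<beta> + 1) = (\<alpha> - \<beta>) * Beta (\<beta> + 1) (\<alpha> - \<beta>)"
      by (simp add: algebra_simps)
    then show ?thesis using assms Beta_pos[of "\<beta> + 1" "\<alpha> - \<beta>"]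
      by (simp add: divide_eq_eq mult.commute nonzero_eq_divide_eq)
  qed
  finally have "1 - (\<integral>r. r\<^sup>2 \<partial>jacobi_radial \<alpha> \<beta>) = (\<alpha> - \<beta>) / (\<alpha> + 1)"
    using int prob_space by simp
  then show ?thesis using assms by (simp add: field_simps)
qed

lemma jacobi_radial_mean:
  assumes "\<alpha> > \<beta>" "\<beta> > -1"
  shows "integrable (jacobi_radial \<alpha> \<beta>) (\<lambda>r. r)" "integrable (jacobi_radial \<alpha> \<beta>) (\<lambda>r. r\<^sup>2)"
   "(\<integral>r. r \<partial>jacobi_radial \<alpha> \<beta>) \<le> sqrt ((\<beta> + 1) / (\<alpha> + 1))"
proof -
  interpret prob_space "jacobi_radial \<alpha> \<beta>" by (rule prob_space_jacobi_radial[OF assms])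
  show 1: "integrable (jacobi_radial \<alpha> \<beta>) (\<lambda>r. r)"
    using AE_jacobi_radial by (intro integrable_const_bound[of _ 1] eventually_mono[OF AE_jacobi_radial]) auto
  show 2: "integrable (jacobi_radial \<alpha> \<beta>) (\<lambda>r. r\<^sup>2)"
    by (intro integrable_const_bound[of _ 1] eventually_mono[OF AE_jacobi_radial])
       (auto simp: abs_square_le_1)
  have "(\<integral>r. r \<partial>jacobi_radial \<alpha> \<beta>)\<^sup>2 \<le> (\<beta> + 1) / (\<alpha> + 1)"
    using variance_eq[OF 1 2] variance_positive[of "\<lambda>r. r"] jacobi_radial_square[OF assms] by simp
  then show "(\<integral>r. r \<partial>jacobi_radial \<alpha> \<beta>) \<le> sqrt ((\<beta> + 1) / (\<alpha> + 1))"
    by (rule real_le_rsqrt)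
qed

lemma sets_jacobi_m [measurable_cong, simp]: "sets (jacobi_m \<alpha> \<beta>) = sets (borel \<Otimes>\<^sub>M borel)"
  unfolding jacobi_m_def by (auto intro!: sets_pair_measure_cong)

text \<open>
  For \<open>\<beta> > -1/2\<close> the density is a product of a function of \<open>r\<close> and a function of \<open>\<phi>\<close>; integrating
  out the angle produces \<open>Beta (1/2) (\<beta> + 1/2)\<close>, which combines with the constant of \<open>jacobi_m\<close> to
  \<open>2 / Beta (\<beta> + 1) (\<alpha> - \<beta>)\<close>.
\<close>

lemma jacobi_m_fst:
  assumes "\<alpha> > \<beta>" "\<beta> \<ge> -1/2"
  shows "distr (jacobi_m \<alpha> \<beta>) borel fst = jacobi_radial \<alpha> \<beta>"
proof (cases "\<beta> = -1/2")
  case True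
  have G: "Gamma (1/2) > (0::real)" "Gamma (\<alpha> + 1) > 0" "Gamma (\<alpha> + 1/2) > 0"
    using assms True by auto
  let ?N = "density lborel (\<lambda>r. ennreal (indicator {0..1} r *
           (2 * Gamma (\<alpha> + 1) / (Gamma (1/2) * Gamma (\<alpha> + 1/2)) * (1 - r\<^sup>2) powr (\<alpha> - 1/2))))"
  interpret P: prob_space "distr (uniform_count_measure {0, pi}) borel (\<lambda>\<phi>. \<phi>)"
    by (intro prob_space.prob_space_distr prob_space_uniform_count_measure)
       (auto simp: measurable_def sets_uniform_count_measure space_uniform_count_measure)
  have "distr (jacobi_m \<alpha> \<beta>) borel fst = distr (jacobi_m \<alpha> \<beta>) ?N fst"
    by (rule distr_cong) auto
  also have "\<dots> = ?N" unfolding jacobi_m_def using True by (simp add: P.distr_pair_fst)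
  also have "\<dots> = jacobi_radial \<alpha> \<beta>"
    unfolding jacobi_radial_def using G True
    \<comment> \<open>Here \<open>r powr (2 * \<beta> + 1)\<close> is \<open>r powr 0\<close>, which is \<open>1\<close> except at \<open>r = 0\<close>.\<close>
    by (intro density_cong eventually_mono[OF AE_lborel_singleton[of 0]])
      (auto split: split_indicator simp: Beta_def add.commute)
  finally show ?thesis .
next
  case False
  then have b: "\<beta> > -1/2" using assms by simp
  have G: "Gamma (1/2) > (0::real)" "Gamma (\<alpha> + 1) > 0" "Gamma (\<alpha> - \<beta>) > 0" "Gamma (\<beta> + 1/2) > 0"
     "Gamma (\<beta> + 1) > 0"
    using assms b by auto
  let ?c = "2 * Gamma (\<alpha> + 1) / (Gamma (1/2) * Gamma (\<alpha> - \<beta>) * Gamma (\<beta> + 1/2))"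
  let ?g = "\<lambda>r. indicator {0..1} r * ((1 - r\<^sup>2) powr (\<alpha> - \<beta> - 1) * r powr (2 * \<beta> + 1)) :: real"
  let ?h = "\<lambda>\<phi>. indicator {0..pi} \<phi> * sin \<phi> powr (2 * \<beta>) :: real"
  have m: "jacobi_m \<alpha> \<beta> = density (lborel \<Otimes>\<^sub>M lborel) (\<lambda>(r, \<phi>). ennreal (?c * ?g r) * ennreal (?h \<phi>))"
  proof -
    have "indicator {0..1} r * indicator {0..pi} \<phi> * (?c *
            (1 - r\<^sup>2) powr (\<alpha> - \<beta> - 1) * (r * sin \<phi>) powr (2 * \<beta>) * r) = (?c * ?g r) * ?h \<phi>" for r \<phi>
    proof (cases "r \<in> {0..1} \<and> \<phi> \<in> {0..pi}")
      case True
      then have "(r * sin \<phi>) powr (2 * \<beta>) = r powr (2 * \<beta>) * sin \<phi> powr (2 * \<beta>)"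
        by (intro powr_mult)
      moreover have "r powr (2 * \<beta>) * r = r powr (2 * \<beta> + 1)"
        using True by (simp add: powr_add)
      ultimately show ?thesis using True by (simp add: mult_ac)
    qed (auto split: split_indicator)
    moreover have "?c * ?g r \<ge> 0" for r using G by (auto split: split_indicator)
    ultimately have "ennreal (indicator {0..1} r * indicator {0..pi} \<phi> * (?c *
            (1 - r\<^sup>2) powr (\<alpha> - \<beta> - 1) * (r * sin \<phi>) powr (2 * \<beta>) * r)) =
        ennreal (?c * ?g r) * ennreal (?h \<phi>)" for r \<phi>
      by (simp only: ennreal_mult')
    then show ?thesis
      unfolding jacobi_m_def using False assms by simp
  qed
  show ?thesis
  proof (rule measure_eqI)
    fix A assume A [measurable]: "A \<in> sets (distr (jacobi_m \<alpha> \<beta>) borel fst)"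
    then have A' [measurable]: "A \<in> sets borel" by simp
    have fst_A: "fst -` A \<in> sets (borel \<Otimes>\<^sub>M borel)"
      using measurable_sets[OF measurable_fst A', of borel] by (simp add: space_pair_measure)
    have "emeasure (distr (jacobi_m \<alpha> \<beta>) borel fst) A = emeasure (jacobi_m \<alpha> \<beta>) (fst -` A)"
      by (subst emeasure_distr) (auto simp: sets_eq_imp_space_eq[OF sets_jacobi_m] space_pair_measure)
    also have "\<dots> = (\<integral>\<^sup>+z. (case z of (r, \<phi>) \<Rightarrow> ennreal (?c * ?g r) * ennreal (?h \<phi>)) * indicator (fst -` A) z \<partial>(lborel \<Otimes>\<^sub>M lborel))"
      unfolding m using fst_A
      by (subst emeasure_density) (auto simp: borel_prod cong: sets_pair_measure_cong)
    also have "\<dots> = (\<integral>\<^sup>+z. ennreal (?c * ?g (fst z)) * indicator A (fst z) * ennreal (?h (snd z)) \<partial>(lborel \<Otimes>\<^sub>M lborel))"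
      by (intro nn_integral_cong) (auto split: split_indicator simp: mult_ac)
    also have "\<dots> = (\<integral>\<^sup>+r. \<integral>\<^sup>+\<phi>. ennreal (?c * ?g r) * indicator A r * ennreal (?h \<phi>) \<partial>lborel \<partial>lborel)"
      by (subst lborel.nn_integral_fst[symmetric]) auto
    also have "\<dots> = (\<integral>\<^sup>+r. ennreal (?c * ?g r) * indicator A r * ennreal (Beta (1/2) (\<beta> + 1/2)) \<partial>lborel)"
      by (subst nn_integral_cmult, measurable, subst nn_integral_sin_powr[OF b]) simp
    also have "\<dots> = (\<integral>\<^sup>+r. ennreal (2 / Beta (\<beta> + 1) (\<alpha> - \<beta>) * ?g r) * indicator A r \<partial>lborel)"
    proof (intro nn_integral_cong)
      fix r :: real
      have "2 * d / (a * b * c) * (a * c / e) = 2 / (e * b / d)"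
        if "a > 0" "b > 0" "c > 0" "d > 0" "e > 0" for a b c d e :: real
        using that by (simp add: field_simps)
      from this[OF G(1,3,4,2,5)]
      have "?c * Beta (1/2) (\<beta> + 1/2) = 2 / Beta (\<beta> + 1) (\<alpha> - \<beta>)"
        by (simp add: Beta_def add.commute)
      moreover have "?c * ?g r * Beta (1/2) (\<beta> + 1/2) = ?c * Beta (1/2) (\<beta> + 1/2) * ?g r"
        by (simp only: mult_ac)
      ultimately have eq: "?c * ?g r * Beta (1/2) (\<beta> + 1/2) = 2 / Beta (\<beta> + 1) (\<alpha> - \<beta>) * ?g r"
        by simp
      have "?c * ?g r \<ge> 0" using G by (auto split: split_indicator)
      then have "ennreal (?c * ?g r) * ennreal (Beta (1/2) (\<beta> + 1/2)) = ennreal (2 / Beta (\<beta> + 1) (\<alpha> - \<beta>) * ?g r)"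
        unfolding eq[symmetric] by (rule ennreal_mult'[symmetric])
      then show "ennreal (?c * ?g r) * indicator A r * ennreal (Beta (1/2) (\<beta> + 1/2)) =
          ennreal (2 / Beta (\<beta> + 1) (\<alpha> - \<beta>) * ?g r) * indicator A r"
        by (simp only: mult_ac)
    qed
    also have "\<dots> = emeasure (jacobi_radial \<alpha> \<beta>) A"
      unfolding jacobi_radial_def by (subst emeasure_density) auto
    finally show "emeasure (distr (jacobi_m \<alpha> \<beta>) borel fst) A = emeasure (jacobi_radial \<alpha> \<beta>) A" .
  qed simp
qed

text \<open>
  A measure with a probability measure as image is itself a probability measure; the normalizing
  constant has already been checked for the marginal.
\<close>

lemma prob_space_jacobi_m:
  assumes "\<alpha> > \<beta>" "\<beta> \<ge> -1/2"
  shows "prob_space (jacobi_m \<alpha> \<beta>)"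
proof -
  have "prob_space (distr (jacobi_m \<alpha> \<beta>) borel fst)"
    unfolding jacobi_m_fst[OF assms] using assms by (intro prob_space_jacobi_radial) auto
  then show ?thesis by (rule prob_space_distrD[rotated]) simp
qed

section \<open>One step in the coordinate ln (cosh x)\<close>

lemma cmod_iexp_diff_le: "cmod (iexp x - iexp y) \<le> \<bar>x - y\<bar>"
proof -
  have "iexp x - iexp y = iexp y * (iexp (x - y) - 1)"
    by (simp add: algebra_simps flip: exp_add)
  then have "cmod (iexp x - iexp y) = cmod (iexp (x - y) - 1)"
    by (simp add: norm_mult)
  also have "\<dots> \<le> \<bar>x - y\<bar>" using iexp_approx1[of "x - y" 0] by simp
  finally show ?thesis .
qed

lemma abs_ln_cmod_one_plus_le:
  fixes z :: complex
  assumes "cmod z \<le> 1/2"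
  shows "\<bar>ln (cmod (1 + z))\<bar> \<le> 2 * cmod z"
proof -
  have lo: "1 - cmod z \<le> cmod (1 + z)" and hi: "cmod (1 + z) \<le> 1 + cmod z"
    using norm_triangle_ineq2[of 1 "- z"] norm_triangle_ineq[of 1 z] by simp_all
  have pos: "cmod (1 + z) > 0" using lo assms by linarith
  have "- cmod z - 2 * (cmod z)\<^sup>2 \<le> ln (1 - cmod z)"
    by (rule ln_one_minus_pos_lower_bound) (use assms in auto)
  moreover have "ln (1 - cmod z) \<le> ln (cmod (1 + z))"
    using lo assms pos by (subst ln_le_cancel_iff) auto
  moreover have "2 * (cmod z)\<^sup>2 \<le> cmod z"
    using mult_right_mono[OF assms, of "cmod z"] by (simp add: power2_eq_square)
  moreover have "ln (cmod (1 + z)) \<le> cmod z"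
    using ln_le_minus_one[OF pos] hi by linarith
  ultimately show ?thesis using norm_ge_zero[of z] by linarith
qed

text \<open>
  The point to which the walk moves from \<open>s\<close> when the jump size is \<open>t\<close> and the pair \<open>(r, \<phi>)\<close> is
  drawn from \<open>jacobi_m\<close>.
\<close>

definition jacobi_step :: "real \<Rightarrow> real \<Rightarrow> real \<times> real \<Rightarrow> real" where
  "jacobi_step s t = (\<lambda>(r, \<phi>). arcosh (cmod (complex_of_real (cosh s * cosh t) +
         complex_of_real r * exp (\<i> * complex_of_real \<phi>) * complex_of_real (sinh s * sinh t))))"

lemma jacobi_conv_point_eq:
  "jacobi_conv_point \<alpha> \<beta> s t = distr (jacobi_m \<alpha> \<beta>) borel (jacobi_step s t)"
  unfolding jacobi_conv_point_def jacobi_step_def ..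

lemma borel_measurable_arcosh [measurable]: "arcosh \<in> borel_measurable (borel :: real measure)"
  unfolding arcosh_def[abs_def] by simp

lemma borel_measurable_cosh [measurable]: "(cosh :: real \<Rightarrow> real) \<in> borel_measurable borel"
  by (intro borel_measurable_continuous_onI continuous_intros)

lemma borel_measurable_sinh [measurable]: "(sinh :: real \<Rightarrow> real) \<in> borel_measurable borel"
  by (intro borel_measurable_continuous_onI continuous_intros)

lemma measurable_jacobi_step [measurable (raw)]:
  assumes [measurable]: "f \<in> borel_measurable M" "g \<in> borel_measurable M" "h \<in> M \<rightarrow>\<^sub>M borel \<Otimes>\<^sub>M borel"
  shows "(\<lambda>x. jacobi_step (f x) (g x) (h x)) \<in> borel_measurable M"
  unfolding jacobi_step_def by (simp add: split_beta')

text \<open>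
  The function \<open>arcosh\<close> is inverted by \<open>cosh\<close> only on \<open>[1, \<infinity>[\<close>. Its argument lies there because
  \<open>cosh s * cosh t - \<bar>sinh s * sinh t\<bar> = cosh (\<bar>s\<bar> - \<bar>t\<bar>) \<ge> 1\<close>. The factor \<open>cosh s * cosh t\<close>
  can then be taken out of the modulus, which makes the step additive up to an error once
  logarithms are taken.
\<close>

lemma cosh_jacobi_step:
  assumes "0 \<le> r" "r \<le> 1"
  shows "cosh (jacobi_step s t (r, \<phi>)) =
    cosh s * cosh t * cmod (1 + r * exp (\<i> * complex_of_real \<phi>) * complex_of_real (tanh s * tanh t))"
proof -
  let ?e = "exp (\<i> * complex_of_real \<phi>)"
  let ?w = "complex_of_real (cosh s * cosh t) + complex_of_real r * ?e * complex_of_real (sinh s * sinh t)"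
  have "cosh s * cosh t - \<bar>sinh s * sinh t\<bar> = cosh (\<bar>s\<bar> - \<bar>t\<bar>)"
    by (simp add: cosh_diff abs_mult)
  then have "1 \<le> cosh s * cosh t - \<bar>sinh s * sinh t\<bar>"
    by (simp add: cosh_real_ge_1)
  also have "\<dots> \<le> cosh s * cosh t - r * \<bar>sinh s * sinh t\<bar>"
    using assms by (simp add: mult_left_le_one_le)
  also have "\<dots> = cmod (complex_of_real (cosh s * cosh t)) -
      cmod (complex_of_real r * ?e * complex_of_real (sinh s * sinh t))"
    using assms by (simp only: norm_mult norm_of_real norm_exp_i_times) (simp add: abs_mult)
  also have "\<dots> \<le> cmod ?w"
    by (rule norm_diff_ineq)
  finally have "cosh (jacobi_step s t (r, \<phi>)) = cmod ?w"
    by (simp add: jacobi_step_def)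
  also have "?w = complex_of_real (cosh s * cosh t) *
      (1 + r * ?e * complex_of_real (tanh s * tanh t))"
    by (simp add: tanh_def field_simps)
  also have "cmod \<dots> = cosh s * cosh t * cmod (1 + r * ?e * complex_of_real (tanh s * tanh t))"
    by (simp only: norm_mult norm_of_real) (simp add: abs_mult)
  finally show ?thesis .
qed

lemma jacobi_step_ln_cosh:
  assumes "0 \<le> r" "r \<le> 1/2"
  shows "\<bar>ln (cosh (jacobi_step s t (r, \<phi>))) - (ln (cosh s) + ln (cosh t))\<bar> \<le> 2 * r"
proof -
  let ?z = "r * exp (\<i> * complex_of_real \<phi>) * complex_of_real (tanh s * tanh t)"
  have "\<bar>tanh x\<bar> \<le> 1" for x :: real
    using tanh_real_lt_1[of x] tanh_real_gt_neg1[of x] by (simp add: abs_le_iff)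
  then have "\<bar>tanh s * tanh t\<bar> \<le> 1"
    by (simp add: abs_mult mult_le_one)
  then have z: "cmod ?z \<le> r"
    using assms by (simp only: norm_mult norm_of_real norm_exp_i_times) (simp add: mult_left_le)
  have "1 - cmod ?z \<le> cmod (1 + ?z)"
    using norm_triangle_ineq2[of 1 "- ?z"] by simp
  then have "cmod (1 + ?z) > 0"
    using z assms by linarith
  then have "ln (cosh (jacobi_step s t (r, \<phi>))) = ln (cosh s) + ln (cosh t) + ln (cmod (1 + ?z))"
    using cosh_jacobi_step[of r s t \<phi>] assms by (simp add: ln_mult)
  then show ?thesis
    using abs_ln_cmod_one_plus_le[of ?z] z assms by linarith
qed

text \<open>
  For \<open>r > 1/2\<close> the logarithm of \<open>cmod (1 + z)\<close> may be arbitrarily large in absolute value, but there the trivial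
  bound \<open>2 \<le> 8 * r\<^sup>2\<close> suffices. The resulting right-hand side does not depend on \<open>s\<close>, \<open>t\<close>
  and \<open>\<phi>\<close>, and its expectation only involves the first two moments of \<open>r\<close>.
\<close>

lemma jacobi_step_iexp:
  assumes "0 \<le> r" "r \<le> 1"
  shows "cmod (iexp (u * ln (cosh (jacobi_step s t (r, \<phi>)))) - iexp (u * ln (cosh s)) * iexp (u * ln (cosh t)))
    \<le> 2 * \<bar>u\<bar> * r + 8 * r\<^sup>2" (is "cmod (iexp (u * ?a) - _) \<le> _")
proof (cases "r \<le> 1/2")
  case True
  have "cmod (iexp (u * ?a) - iexp (u * (ln (cosh s) + ln (cosh t)))) \<le>
      \<bar>u * ?a - u * (ln (cosh s) + ln (cosh t))\<bar>"
    by (rule cmod_iexp_diff_le)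
  also have "\<dots> = \<bar>u\<bar> * \<bar>?a - (ln (cosh s) + ln (cosh t))\<bar>"
    by (simp flip: abs_mult right_diff_distrib)
  also have "\<dots> \<le> \<bar>u\<bar> * (2 * r)"
    using True assms by (intro mult_left_mono jacobi_step_ln_cosh) auto
  also have "iexp (u * (ln (cosh s) + ln (cosh t))) = iexp (u * ln (cosh s)) * iexp (u * ln (cosh t))"
    by (simp add: ring_distribs exp_add)
  finally show ?thesis using zero_le_power2[of r] by linarith
next
  case False
  have "cmod (iexp (u * ?a) - iexp (u * ln (cosh s)) * iexp (u * ln (cosh t))) \<le> 1 + 1"
    by (rule order.trans[OF norm_triangle_ineq4]) (simp add: norm_mult)
  also have "\<dots> \<le> 8 * r\<^sup>2" using power_mono[of "1/2" r 2] False by (simp add: power2_eq_square)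
  finally show ?thesis using assms by (simp add: add_increasing)
qed

section \<open>Evolution of the laws of the walk\<close>

lemma distr_pair_snd:
  assumes "prob_space P" "prob_space Q"
  shows "distr (P \<Otimes>\<^sub>M Q) Q snd = Q"
proof (rule measure_eqI)
  interpret P: prob_space P by fact
  interpret Q: prob_space Q by fact
  fix A assume "A \<in> sets (distr (P \<Otimes>\<^sub>M Q) Q snd)"
  then have A: "A \<in> sets Q" by simp
  then have "snd -` A \<inter> space (P \<Otimes>\<^sub>M Q) = space P \<times> A"
    using sets.sets_into_space[OF A] by (auto simp: space_pair_measure)
  then show "emeasure (distr (P \<Otimes>\<^sub>M Q) Q snd) A = emeasure Q A"
    using A by (simp add: emeasure_distr Q.emeasure_pair_measure_Times P.emeasure_space_1)
qed simp

locale jacobi_kernel = \<nu>: prob_space \<nu> for \<alpha> \<beta> :: real and \<nu> :: "real measure" +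
  assumes \<alpha>_gt: "\<alpha> > \<beta>" and \<beta>_ge: "\<beta> \<ge> -1/2" and sets_\<nu> [measurable_cong, simp]: "sets \<nu> = sets borel"
begin

sublocale m: prob_space "jacobi_m \<alpha> \<beta>"
  using \<alpha>_gt \<beta>_ge by (rule prob_space_jacobi_m)

lemma space_\<nu> [simp]: "space \<nu> = UNIV"
  using sets_eq_imp_space_eq[OF sets_\<nu>] by simp

text \<open>
  The joint law of the jump size \<open>t\<close> and of \<open>(r, \<phi>)\<close>, that is, of the randomness that enters a
  single step independently of the current position.
\<close>

abbreviation "innovation_law \<equiv> \<nu> \<Otimes>\<^sub>M jacobi_m \<alpha> \<beta>"

sublocale innov: prob_space innovation_law
  by (rule prob_space_pair) unfold_locales

text \<open>
  Joint measurability in \<open>(s, t)\<close> is what gives the iterated \<open>bind\<close> in \<open>jacobi_conv\<close> its meaning as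
  a mixture.
\<close>

lemma measurable_jacobi_conv_point:
  "(\<lambda>(s, t). jacobi_conv_point \<alpha> \<beta> s t) \<in> borel \<Otimes>\<^sub>M borel \<rightarrow>\<^sub>M subprob_algebra borel"
proof -
  have "jacobi_m \<alpha> \<beta> \<in> space (subprob_algebra (borel \<Otimes>\<^sub>M borel))"
    by (simp add: space_subprob_algebra m.subprob_space_axioms)
  then have "(\<lambda>st. distr (jacobi_m \<alpha> \<beta>) borel (jacobi_step (fst st) (snd st)))
      \<in> borel \<Otimes>\<^sub>M borel \<rightarrow>\<^sub>M subprob_algebra borel"
    by (intro measurable_distr2[where M = "borel \<Otimes>\<^sub>M borel"] measurable_const) simp_all
  then show ?thesis
    by (simp add: jacobi_conv_point_eq split_beta')
qed

lemma jacobi_conv_return: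
  "jacobi_conv \<alpha> \<beta> (return borel s) \<nu> = distr innovation_law borel (\<lambda>(t, p). jacobi_step s t p)"
proof (rule measure_eqI)
  have kernel: "jacobi_conv_point \<alpha> \<beta> s \<in> \<nu> \<rightarrow>\<^sub>M subprob_algebra borel" for s
    using measurable_compose_Pair1[OF _ measurable_jacobi_conv_point, of s] by simp
  have "(\<lambda>s. \<nu> \<bind> jacobi_conv_point \<alpha> \<beta> s) \<in> borel \<rightarrow>\<^sub>M subprob_algebra borel"
    using measurable_jacobi_conv_point
    by (intro measurable_bind'[where N = borel] measurable_const)
      (simp_all add: space_subprob_algebra \<nu>.subprob_space_axioms)
  then have eq: "jacobi_conv \<alpha> \<beta> (return borel s) \<nu> = \<nu> \<bind> jacobi_conv_point \<alpha> \<beta> s"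
    unfolding jacobi_conv_def by (simp add: bind_return)
  then show sets: "sets (jacobi_conv \<alpha> \<beta> (return borel s) \<nu>) = sets (distr innovation_law borel (\<lambda>(t, p). jacobi_step s t p))"
    using sets_bind[of \<nu> "jacobi_conv_point \<alpha> \<beta> s" borel] sets_kernel[OF kernel] by simp
  fix A assume "A \<in> sets (jacobi_conv \<alpha> \<beta> (return borel s) \<nu>)"
  with sets have A [measurable]: "A \<in> sets borel" by simp
  have "emeasure (jacobi_conv \<alpha> \<beta> (return borel s) \<nu>) A = (\<integral>\<^sup>+t. emeasure (jacobi_conv_point \<alpha> \<beta> s t) A \<partial>\<nu>)"
    unfolding eq by (rule emeasure_bind[OF _ kernel A]) simp
  also have "\<dots> = (\<integral>\<^sup>+t. \<integral>\<^sup>+p. indicator A (jacobi_step s t p) \<partial>jacobi_m \<alpha> \<beta> \<partial>\<nu>)"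
    by (simp add: jacobi_conv_point_eq nn_integral_distr flip: nn_integral_indicator)
  also have "\<dots> = (\<integral>\<^sup>+z. indicator A (jacobi_step s (fst z) (snd z)) \<partial>innovation_law)"
    by (subst m.nn_integral_fst[symmetric]) simp_all
  also have "\<dots> = emeasure (distr innovation_law borel (\<lambda>(t, p). jacobi_step s t p)) A"
    by (simp add: split_beta' nn_integral_distr flip: nn_integral_indicator)
  finally show "emeasure (jacobi_conv \<alpha> \<beta> (return borel s) \<nu>) A =
     emeasure (distr innovation_law borel (\<lambda>(t, p). jacobi_step s t p)) A" .
qed

end

lemma subalgebra_past_sigma:
  assumes "\<And>i. S i \<in> borel_measurable M"
  shows "subalgebra M (past_sigma M S n)"
proof -
  let ?G = "{S i -` A \<inter> space M | i A. i \<le> n \<and> A \<in> sets borel}"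
  have G: "?G \<subseteq> sets M"
    using measurable_sets[OF assms] by auto
  have "?G \<subseteq> Pow (space M)" by auto
  then have "sets (past_sigma M S n) = sigma_sets (space M) ?G"
    unfolding past_sigma_def by (rule sets_measure_of)
  also have "\<dots> \<subseteq> sets M"
    by (rule sets.sigma_sets_subset[OF G])
  finally show ?thesis
    by (simp add: subalgebra_def past_sigma_def space_measure_of_conv)
qed

context jacobi_kernel begin

lemma measurable_step_kernel:
  "(\<lambda>(s, t, p). jacobi_step s t p) \<in> borel \<Otimes>\<^sub>M innovation_law \<rightarrow>\<^sub>M borel"
  unfolding split_beta' by simp

lemma measure_jacobi_conv_return:
  assumes [measurable]: "A \<in> sets borel"
  shows "ennreal (measure (jacobi_conv \<alpha> \<beta> (return borel s) \<nu>) A) =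
    (\<integral>\<^sup>+z. indicator A (jacobi_step s (fst z) (snd z)) \<partial>innovation_law)"
proof -
  interpret D: prob_space "distr innovation_law borel (\<lambda>(t, p). jacobi_step s t p)"
    by (rule innov.prob_space_distr) (simp add: split_beta')
  have "(\<integral>\<^sup>+z. indicator A (jacobi_step s (fst z) (snd z)) \<partial>innovation_law) =
      emeasure (distr innovation_law borel (\<lambda>(t, p). jacobi_step s t p)) A"
    by (subst nn_integral_indicator[symmetric], simp, subst nn_integral_distr) (simp_all add: split_beta')
  then show ?thesis
    unfolding jacobi_conv_return by (simp only: D.emeasure_eq_measure)
qed

text \<open>
  If the position has law \<open>P\<close> and the innovation is independent of it, then the next position has
  the \<open>P\<close>-mixture of the convolutions with \<open>\<nu>\<close> as its law.
\<close>

lemma emeasure_step_kernel: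
  assumes [measurable_cong]: "sets P = sets borel" and A [measurable]: "A \<in> sets borel"
  shows "emeasure (distr (P \<Otimes>\<^sub>M innovation_law) borel (\<lambda>(s, t, p). jacobi_step s t p)) A =
    (\<integral>\<^sup>+s. ennreal (measure (jacobi_conv \<alpha> \<beta> (return borel s) \<nu>) A) \<partial>P)"
proof -
  have "emeasure (distr (P \<Otimes>\<^sub>M innovation_law) borel (\<lambda>(s, t, p). jacobi_step s t p)) A =
      (\<integral>\<^sup>+z. indicator A (jacobi_step (fst z) (fst (snd z)) (snd (snd z))) \<partial>(P \<Otimes>\<^sub>M innovation_law))"
    by (subst nn_integral_indicator[symmetric], simp, subst nn_integral_distr) (simp_all add: split_beta')
  also have "\<dots> = (\<integral>\<^sup>+s. \<integral>\<^sup>+z. indicator A (jacobi_step s (fst z) (snd z)) \<partial>innovation_law \<partial>P)"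
    by (subst innov.nn_integral_fst[symmetric]) simp_all
  finally show ?thesis unfolding measure_jacobi_conv_return[OF A] .
qed

text \<open>
  Taking expectations in the Markov property leaves a recursion for the laws of the positions alone.
  The Markov property only speaks about subsets of \<open>[0, \<infinity>[\<close>. Since it gives the right-hand
  side full mass on \<open>[0, \<infinity>[\<close>, the two laws agree on all Borel sets.
\<close>

lemma random_walk_Suc:
  assumes walk: "jacobi_random_walk \<alpha> \<beta> \<nu> M S"
  shows "distr M borel (S (Suc n)) =
    distr (distr M borel (S n) \<Otimes>\<^sub>M innovation_law) borel (\<lambda>(s, t, p). jacobi_step s t p)" (is "?L = ?R")
proof -
  interpret M: prob_space M using assms by (simp add: jacobi_random_walk_def)
  have Sr: "S n \<in> M \<rightarrow>\<^sub>M restrict_space borel {0..}" for n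
    using assms by (simp add: jacobi_random_walk_def)
  then have S [measurable]: "S n \<in> borel_measurable M" for n
    by (rule measurable_restrict_space2_iff[THEN iffD1, THEN conjunct1])
  have S_nonneg: "S n \<omega> \<ge> 0" if "\<omega> \<in> space M" for n \<omega>
    using measurable_space[OF Sr that] by (simp add: space_restrict_space)
  let ?P = "distr M borel (S n)"
  interpret P: prob_space ?P by (rule M.prob_space_distr) simp
  interpret R: prob_space ?R
    using measurable_step_kernel
    by (intro prob_space.prob_space_distr prob_space_pair P.prob_space_axioms innov.prob_space_axioms)
      (simp cong: measurable_cong_sets sets_pair_measure_cong)
  interpret L: prob_space ?L by (rule M.prob_space_distr) simp
  interpret F: finite_measure_subalgebra M "past_sigma M S n"
    by unfold_locales (rule subalgebra_past_sigma[OF S])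
  have eq: "emeasure ?L A = emeasure ?R A" if A [measurable]: "A \<in> sets borel" and "A \<subseteq> {0..}" for A
  proof -
    let ?k = "\<lambda>s. measure (jacobi_conv \<alpha> \<beta> (return borel s) \<nu>) A"
    let ?c = "real_cond_exp M (past_sigma M S n) (\<lambda>\<omega>'. indicator A (S (Suc n) \<omega>'))"
    have int: "integrable M (\<lambda>\<omega>. indicator A (S (Suc n) \<omega>) :: real)"
      by (intro M.integrable_const_bound[of _ 1]) auto
    have ae: "AE \<omega> in M. ?c \<omega> = ?k (S n \<omega>)"
      using walk that unfolding jacobi_random_walk_def by blast
    have "ennreal (measure ?L A) = ennreal (\<integral>\<omega>. indicator A (S (Suc n) \<omega>) \<partial>M)"
      using integral_distr[of "S (Suc n)" M borel "indicat_real A"] by simp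
    also have "(\<integral>\<omega>. indicator A (S (Suc n) \<omega>) \<partial>M) = (\<integral>\<omega>. ?c \<omega> \<partial>M)"
      by (rule F.real_cond_exp_int(2)[OF int, symmetric])
    also have "ennreal \<dots> = (\<integral>\<^sup>+\<omega>. ennreal (?c \<omega>) \<partial>M)"
      by (intro nn_integral_eq_integral[symmetric] F.real_cond_exp_int(1)[OF int] eventually_mono[OF ae]) simp
    also have "\<dots> = (\<integral>\<^sup>+\<omega>. ennreal (?k (S n \<omega>)) \<partial>M)"
      by (intro nn_integral_cong_AE eventually_mono[OF ae]) simp
    also have "\<dots> = (\<integral>\<^sup>+s. ennreal (?k s) \<partial>?P)"
      unfolding measure_jacobi_conv_return[OF A] by (subst nn_integral_distr) simp_all
    also have "\<dots> = emeasure ?R A"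
      by (rule emeasure_step_kernel[symmetric]) simp_all
    finally show ?thesis by (simp only: L.emeasure_eq_measure)
  qed
  have L0: "AE x in ?L. x \<in> {0..}"
    using S_nonneg by (subst AE_distr_iff) auto
  then have "emeasure ?R {0..} = 1"
    using eq[of "{0..}"] L.prob_eq_1[of "{0..}"] by (simp add: L.emeasure_eq_measure)
  then have R0: "AE x in ?R. x \<in> {0..}"
    using R.prob_eq_1[of "{0..}"] by (simp add: R.emeasure_eq_measure)
  show ?thesis
  proof (rule measure_eqI)
    fix A assume A: "A \<in> sets ?L"
    have "emeasure ?L A = emeasure ?L (A \<inter> {0..})"
      using A by (intro emeasure_eq_AE eventually_mono[OF L0]) auto
    also have "\<dots> = emeasure ?R (A \<inter> {0..})"
      using A by (intro eq) auto
    also have "\<dots> = emeasure ?R A"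
      using A by (intro emeasure_eq_AE eventually_mono[OF R0]) auto
    finally show "emeasure ?L A = emeasure ?R A" .
  qed simp
qed

end

section \<open>Accumulation of the errors of the characteristic functions\<close>

lemma (in pair_prob_space) integral_times:
  fixes f g :: "_ \<Rightarrow> complex"
  assumes [measurable]: "f \<in> borel_measurable M1" "g \<in> borel_measurable M2"
    and "\<And>x. norm (f x) \<le> 1" "\<And>y. norm (g y) \<le> 1"
  shows "(\<integral>z. f (fst z) * g (snd z) \<partial>(M1 \<Otimes>\<^sub>M M2)) = (\<integral>x. f x \<partial>M1) * (\<integral>y. g y \<partial>M2)"
proof -
  have "integrable (M1 \<Otimes>\<^sub>M M2) (\<lambda>z. f (fst z) * g (snd z))"
    by (rule P.integrable_const_bound[of _ 1]) (use assms in \<open>auto simp: norm_mult intro!: mult_le_one\<close>)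
  from integral_fst'[OF this] show ?thesis by simp
qed

context jacobi_kernel begin

text \<open>
  Under independence of position and innovation, the product of the two characteristic functions is
  the expectation of \<open>iexp (u * (ln (cosh s) + ln (cosh t)))\<close>. The pointwise bound
  \<open>jacobi_step_iexp\<close> is integrated, and the first moment of \<open>r\<close> is at most the square root of the
  second.
\<close>

lemma char_step_error:
  assumes "prob_space P" and sets_P [measurable_cong]: "sets P = sets borel"
  shows "cmod ((\<integral>x. iexp (u * ln (cosh x)) \<partial>distr (P \<Otimes>\<^sub>M innovation_law) borel (\<lambda>(s, t, p). jacobi_step s t p)) -
     (\<integral>s. iexp (u * ln (cosh s)) \<partial>P) * (\<integral>t. iexp (u * ln (cosh t)) \<partial>\<nu>))
    \<le> 2 * \<bar>u\<bar> * sqrt ((\<beta> + 1) / (\<alpha> + 1)) + 8 * ((\<beta> + 1) / (\<alpha> + 1))"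
proof -
  interpret P: prob_space P by fact
  interpret PK: pair_prob_space P innovation_law by unfold_locales
  let ?R = "P \<Otimes>\<^sub>M innovation_law"
  let ?f = "\<lambda>z. iexp (u * ln (cosh (jacobi_step (fst z) (fst (snd z)) (snd (snd z)))))"
  let ?g = "\<lambda>z :: real \<times> real \<times> real \<times> real. iexp (u * ln (cosh (fst z))) * iexp (u * ln (cosh (fst (snd z))))"
  let ?r = "\<lambda>z :: real \<times> real \<times> real \<times> real. fst (snd (snd z))"
  have f: "integrable ?R ?f" and g: "integrable ?R ?g"
    by (rule PK.P.integrable_const_bound[of _ 1]; simp add: norm_mult)+
  have "distr ?R borel ?r = distr (distr (distr ?R innovation_law snd) (jacobi_m \<alpha> \<beta>) snd) borel fst"
    by (subst distr_distr, simp_all add: comp_def)+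
  also have "distr ?R innovation_law snd = innovation_law"
    by (rule distr_pair_snd) unfold_locales
  also have "distr innovation_law (jacobi_m \<alpha> \<beta>) snd = jacobi_m \<alpha> \<beta>"
    by (rule distr_pair_snd) unfold_locales
  also have "distr (jacobi_m \<alpha> \<beta>) borel fst = jacobi_radial \<alpha> \<beta>"
    using \<alpha>_gt \<beta>_ge by (rule jacobi_m_fst)
  finally have r: "distr ?R borel ?r = jacobi_radial \<alpha> \<beta>" .
  have r_measurable: "?r \<in> borel_measurable ?R" by measurable
  have AE_r: "AE z in ?R. 0 \<le> ?r z \<and> ?r z \<le> 1"
    using AE_distrD[OF r_measurable, of "\<lambda>r. 0 \<le> r \<and> r \<le> 1"] AE_jacobi_radial[of \<alpha> \<beta>]
    unfolding r by simp
  have \<beta>: "\<beta> > -1" using \<beta>_ge by simp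
  note rad = jacobi_radial_mean[OF \<alpha>_gt \<beta>] jacobi_radial_square[OF \<alpha>_gt \<beta>]
  have r_int: "integrable ?R (\<lambda>z. 2 * \<bar>u\<bar> * ?r z + 8 * (?r z)\<^sup>2)"
    using rad(1,2) by (intro integrable_distr[OF r_measurable, of "\<lambda>r. 2 * \<bar>u\<bar> * r + 8 * r\<^sup>2"])
      (simp only: r Bochner_Integration.integrable_add integrable_mult_right)
  have "(\<integral>x. iexp (u * ln (cosh x)) \<partial>distr ?R borel (\<lambda>(s, t, p). jacobi_step s t p)) = (\<integral>z. ?f z \<partial>?R)"
    by (subst integral_distr) (simp_all add: split_beta')
  moreover have "(\<integral>s. iexp (u * ln (cosh s)) \<partial>P) * (\<integral>t. iexp (u * ln (cosh t)) \<partial>\<nu>) = (\<integral>z. ?g z \<partial>?R)"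
  proof -
    have "(\<integral>z. ?g z \<partial>?R) = (\<integral>s. iexp (u * ln (cosh s)) \<partial>P) * (\<integral>q. iexp (u * ln (cosh (fst q))) \<partial>innovation_law)"
      by (rule PK.integral_times) simp_all
    also have "(\<integral>q. iexp (u * ln (cosh (fst q))) \<partial>innovation_law) = (\<integral>t. iexp (u * ln (cosh t)) \<partial>distr innovation_law \<nu> fst)"
      by (subst integral_distr) simp_all
    also have "distr innovation_law \<nu> fst = \<nu>" by (rule m.distr_pair_fst)
    finally show ?thesis ..
  qed
  ultimately have "cmod ((\<integral>x. iexp (u * ln (cosh x)) \<partial>distr ?R borel (\<lambda>(s, t, p). jacobi_step s t p)) -
     (\<integral>s. iexp (u * ln (cosh s)) \<partial>P) * (\<integral>t. iexp (u * ln (cosh t)) \<partial>\<nu>)) = cmod (\<integral>z. ?f z - ?g z \<partial>?R)"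
    by (simp only: Bochner_Integration.integral_diff[OF f g])
  also have "\<dots> \<le> (\<integral>z. cmod (?f z - ?g z) \<partial>?R)"
    by (rule integral_norm_bound)
  also have "\<dots> \<le> (\<integral>z. 2 * \<bar>u\<bar> * ?r z + 8 * (?r z)\<^sup>2 \<partial>?R)"
  proof (intro integral_mono_AE r_int eventually_mono[OF AE_r])
    show "integrable ?R (\<lambda>z. cmod (?f z - ?g z))"
      using f g by (intro integrable_norm Bochner_Integration.integrable_diff)
    fix z assume z: "0 \<le> ?r z \<and> ?r z \<le> 1"
    show "cmod (?f z - ?g z) \<le> 2 * \<bar>u\<bar> * ?r z + 8 * (?r z)\<^sup>2"
      using jacobi_step_iexp[OF conjunct1[OF z] conjunct2[OF z], of u "fst z" "fst (snd z)" "snd (snd (snd z))"]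
      by (simp only: prod.collapse)
  qed
  also have "\<dots> = (\<integral>r. 2 * \<bar>u\<bar> * r + 8 * r\<^sup>2 \<partial>jacobi_radial \<alpha> \<beta>)"
    unfolding r[symmetric] by (rule integral_distr[OF r_measurable, symmetric]) simp
  also have "\<dots> = 2 * \<bar>u\<bar> * (\<integral>r. r \<partial>jacobi_radial \<alpha> \<beta>) + 8 * ((\<beta> + 1) / (\<alpha> + 1))"
    using rad(1,2) by (simp only: rad(4) Bochner_Integration.integral_add integrable_mult_right integral_mult_right_zero)
  also have "\<dots> \<le> 2 * \<bar>u\<bar> * sqrt ((\<beta> + 1) / (\<alpha> + 1)) + 8 * ((\<beta> + 1) / (\<alpha> + 1))"
    using rad(3) by (intro add_right_mono mult_left_mono) simp_all
  finally show ?thesis .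
qed

text \<open>
  The errors add up because characteristic functions are bounded by \<open>1\<close>, so that an earlier error
  is not magnified by the later steps.
\<close>

lemma random_walk_char_error:
  assumes walk: "jacobi_random_walk \<alpha> \<beta> \<nu> M S"
  shows "cmod ((\<integral>\<omega>. iexp (u * ln (cosh (S n \<omega>))) \<partial>M) - (\<integral>t. iexp (u * ln (cosh t)) \<partial>\<nu>) ^ n)
    \<le> real n * (2 * \<bar>u\<bar> * sqrt ((\<beta> + 1) / (\<alpha> + 1)) + 8 * ((\<beta> + 1) / (\<alpha> + 1)))" (is "_ \<le> _ * ?e")
proof (induction n)
  interpret M: prob_space M using walk by (simp add: jacobi_random_walk_def)
  have [measurable]: "S 0 \<in> borel_measurable M" and S0: "AE \<omega> in M. S 0 \<omega> = 0"
    using walk by (simp_all add: jacobi_random_walk_def measurable_restrict_space2_iff)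
  case 0
  have "(\<integral>\<omega>. iexp (u * ln (cosh (S 0 \<omega>))) \<partial>M) = (\<integral>\<omega>. 1 \<partial>M)"
    by (intro integral_cong_AE eventually_mono[OF S0]) simp_all
  then show ?case using M.prob_space by simp
next
  interpret M: prob_space M using walk by (simp add: jacobi_random_walk_def)
  have S [measurable]: "S n \<in> borel_measurable M" for n
    using walk by (simp add: jacobi_random_walk_def measurable_restrict_space2_iff)
  case (Suc n)
  let ?\<chi> = "\<lambda>n. \<integral>\<omega>. iexp (u * ln (cosh (S n \<omega>))) \<partial>M"
  let ?\<psi> = "\<integral>t. iexp (u * ln (cosh t)) \<partial>\<nu>"
  have \<chi>: "?\<chi> n = (\<integral>x. iexp (u * ln (cosh x)) \<partial>distr M borel (S n))" for n
    by (simp add: integral_distr)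
  have "cmod ?\<psi> \<le> (\<integral>t. cmod (iexp (u * ln (cosh t))) \<partial>\<nu>)" by (rule integral_norm_bound)
  then have \<psi>: "cmod ?\<psi> \<le> 1" using \<nu>.prob_space by simp
  have "cmod (?\<chi> (Suc n) - ?\<chi> n * ?\<psi>) \<le> ?e"
    unfolding \<chi> random_walk_Suc[OF walk] by (rule char_step_error) (simp_all add: M.prob_space_distr)
  moreover have "cmod (?\<chi> n * ?\<psi> - ?\<psi> ^ n * ?\<psi>) \<le> real n * ?e"
  proof -
    have "cmod (?\<chi> n * ?\<psi> - ?\<psi> ^ n * ?\<psi>) = cmod (?\<chi> n - ?\<psi> ^ n) * cmod ?\<psi>"
      by (simp only: norm_mult flip: left_diff_distrib)
    also have "\<dots> \<le> cmod (?\<chi> n - ?\<psi> ^ n)"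
      using \<psi> by (intro mult_right_le_one_le) auto
    finally show ?thesis using Suc by simp
  qed
  ultimately have "cmod ((?\<chi> (Suc n) - ?\<chi> n * ?\<psi>) + (?\<chi> n * ?\<psi> - ?\<psi> ^ n * ?\<psi>)) \<le> ?e + real n * ?e"
    by (rule norm_triangle_mono)
  moreover have "(a - b) + (b - c) = a - c" for a b c :: complex by simp
  moreover have "?e + real n * ?e = real (Suc n) * ?e"
    by (simp only: of_nat_Suc ring_distribs mult_1)
  ultimately show ?case by (simp only: power_Suc2)
qed

end

section \<open>The Gaussian limit of powers of a characteristic function\<close>

text \<open>
  The analytic core of the central limit theorem: \<open>char M (t / sqrt n)\<close> differs from
  \<open>1 - t\<^sup>2 * v / (2 * n)\<close> by \<open>o(1 / n)\<close>, and \<open>n\<close>-th powers of complex numbers in the unit disc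
  differ by at most \<open>n\<close> times the difference of their bases. The variance \<open>v\<close> may vanish.
\<close>

lemma (in real_distribution) char_power_tendsto:
  assumes int1: "integrable M (\<lambda>x. x)" and mean: "expectation (\<lambda>x. x) = 0"
    and int2: "integrable M (\<lambda>x. x\<^sup>2)" and var: "expectation (\<lambda>x. x\<^sup>2) = v"
  shows "(\<lambda>n. char M (t / sqrt (real n)) ^ n) \<longlonglongrightarrow> complex_of_real (exp (- (t\<^sup>2 * v) / 2))"
proof -
  let ?t = "\<lambda>n. t / sqrt (real n)"
  let ?x = "- (t\<^sup>2 * v) / 2"
  let ?I = "\<lambda>n. expectation (\<lambda>x. min (6 * x\<^sup>2) (\<bar>?t n\<bar> * \<bar>x\<bar> ^ 3))"
  have v: "v \<ge> 0" unfolding var[symmetric] by simp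
  have var': "variance (\<lambda>x. x) = v" using mean var by simp
  have bound: "cmod (char M (?t n) ^ n - complex_of_real ((1 + ?x / n) ^ n)) \<le> t\<^sup>2 / 6 * ?I n"
    \<comment> \<open>For these \<open>n\<close> the number \<open>1 - t\<^sup>2 * v / (2 * n)\<close> lies in \<open>[-1, 1]\<close>.\<close>
    if n: "n \<ge> max 1 (nat \<lceil>t\<^sup>2 * v / 4\<rceil>)" for n
  proof -
    have n0: "n > 0" and n4: "t\<^sup>2 * v / 4 \<le> n" using n by (auto simp: nat_ceiling_le_eq)
    have "cmod (char M (?t n) - (1 - (?t n)\<^sup>2 * v / 2)) \<le> (?t n)\<^sup>2 / 6 * ?I n"
      by (rule char_approx3[OF int1 mean int2 var'])
    also have "1 - (?t n)\<^sup>2 * v / 2 = 1 + ?x / n"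
      by (simp add: power_divide)
    finally have *: "cmod (char M (?t n) - complex_of_real (1 + ?x / n)) \<le> (?t n)\<^sup>2 / 6 * ?I n" .
    have "\<bar>1 + ?x / n\<bar> \<le> 1"
      using n0 n4 v by (intro abs_leI) (auto simp: field_simps)
    then have "cmod (complex_of_real (1 + ?x / n)) \<le> 1"
      by (simp only: norm_of_real)
    from norm_power_diff[OF cmod_char_le_1 this]
    have "cmod (char M (?t n) ^ n - complex_of_real (1 + ?x / n) ^ n) \<le>
        n * cmod (char M (?t n) - complex_of_real (1 + ?x / n))" .
    also have "\<dots> \<le> n * ((?t n)\<^sup>2 / 6 * ?I n)"
      by (rule mult_left_mono[OF *]) simp
    also have "\<dots> = t\<^sup>2 / 6 * ?I n" using n0 by (simp add: power_divide)
    finally show ?thesis by (simp only: of_real_power)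
  qed
  have "(\<lambda>n. min (6 * x\<^sup>2) (\<bar>?t n\<bar> * \<bar>x\<bar> ^ 3)) \<longlonglongrightarrow> 0" for x
  proof -
    have "?t \<longlonglongrightarrow> 0"
      by (intro tendsto_divide_0[OF tendsto_const] filterlim_at_top_imp_at_infinity
         filterlim_compose[OF sqrt_at_top filterlim_real_sequentially])
    then have "(\<lambda>n. min (6 * x\<^sup>2) (\<bar>?t n\<bar> * \<bar>x\<bar> ^ 3)) \<longlonglongrightarrow> min (6 * x\<^sup>2) (\<bar>0\<bar> * \<bar>x\<bar> ^ 3)"
      by (intro tendsto_intros)
    then show ?thesis by (simp add: min_absorb2)
  qed
  then have "?I \<longlonglongrightarrow> expectation (\<lambda>x. 0)"
    using int2 by (intro integral_dominated_convergence[where w = "\<lambda>x. 6 * x\<^sup>2"]) auto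
  then have "(\<lambda>n. t\<^sup>2 / 6 * ?I n) \<longlonglongrightarrow> 0"
    by (simp only: integral_zero tendsto_mult_right_zero)
  then have diff: "(\<lambda>n. char M (?t n) ^ n - complex_of_real ((1 + ?x / n) ^ n)) \<longlonglongrightarrow> 0"
    by (rule Lim_null_comparison[rotated]) (use bound in \<open>rule eventually_sequentiallyI\<close>)
  have "(\<lambda>n. complex_of_real ((1 + ?x / n) ^ n)) \<longlonglongrightarrow> complex_of_real (exp ?x)"
    by (intro tendsto_of_real tendsto_exp_limit_sequentially)
  from tendsto_add[OF diff this] show ?thesis by simp
qed

text \<open>
  This description has the same form for positive and for vanishing variance, so the characteristic
  function of the standard normal distribution yields the one of \<open>normal_law\<close> in both cases at once.
\<close>

lemma normal_law_eq_distr: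
  assumes "v \<ge> 0"
  shows "normal_law 0 v = distr std_normal_distribution borel (\<lambda>x. sqrt v * x)"
proof -
  interpret N: real_distribution std_normal_distribution by (rule real_dist_normal_dist)
  show ?thesis
  proof (cases "v = 0")
    case True
    then show ?thesis by (simp add: normal_law_def)
  next
    case False
    have "distributed std_normal_distribution lborel (\<lambda>x. x) std_normal_density"
      by (auto simp: distributed_def distr_id2)
    from N.normal_density_affine[OF this, of "sqrt v" 0] assms False
    have "distributed std_normal_distribution lborel (\<lambda>x. sqrt v * x) (normal_density 0 (sqrt v))"
      by simp
    then have "distr std_normal_distribution lborel (\<lambda>x. sqrt v * x) = density lborel (normal_density 0 (sqrt v))"
      by (simp add: distributed_def)
    moreover have "distr std_normal_distribution lborel (\<lambda>x. sqrt v * x) = distr std_normal_distribution borel (\<lambda>x. sqrt v * x)"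
      by (rule distr_cong) simp_all
    ultimately show ?thesis using False by (simp add: normal_law_def)
  qed
qed

lemma real_distribution_normal_law:
  assumes "v \<ge> 0"
  shows "real_distribution (normal_law 0 v)"
proof -
  interpret N: real_distribution std_normal_distribution by (rule real_dist_normal_dist)
  show ?thesis
    unfolding normal_law_eq_distr[OF assms] by (rule N.real_distribution_distr) simp
qed

lemma char_normal_law:
  assumes "v \<ge> 0"
  shows "char (normal_law 0 v) t = complex_of_real (exp (- (t\<^sup>2 * v) / 2))"
proof -
  have "char (normal_law 0 v) t = char std_normal_distribution (sqrt v * t)"
    unfolding normal_law_eq_distr[OF assms] char_def by (subst integral_distr) (simp_all add: mult_ac)
  then show ?thesis using assms by (simp add: char_std_normal_distribution power_mult_distrib mult.commute)
qed

section \<open>The central limit theorem for the Jacobi random walk\<close>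

lemma ln_cosh_bounds:
  fixes x :: real
  shows "0 \<le> ln (cosh x)" "ln (cosh x) \<le> \<bar>x\<bar>" "\<bar>x\<bar> - ln 2 \<le> ln (cosh x)"
proof -
  show "0 \<le> ln (cosh x)" by (simp add: cosh_real_ge_1)
  have c: "2 * cosh x = exp \<bar>x\<bar> + exp (- \<bar>x\<bar>)"
    by (cases "x \<ge> 0") (simp_all add: cosh_def)
  have "exp (- \<bar>x\<bar>) \<le> exp \<bar>x\<bar>" "exp (- \<bar>x\<bar>) > 0" by simp_all
  with c have le: "cosh x \<le> exp \<bar>x\<bar>" "exp \<bar>x\<bar> / 2 \<le> cosh x"
    by linarith+
  have "ln (cosh x) \<le> ln (exp \<bar>x\<bar>)"
    by (rule ln_le_cancel_iff[THEN iffD2, OF cosh_real_pos exp_gt_zero le(1)])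
  then show "ln (cosh x) \<le> \<bar>x\<bar>" by (simp only: ln_exp)
  have "ln (exp \<bar>x\<bar> / 2) \<le> ln (cosh x)"
    by (rule ln_le_cancel_iff[THEN iffD2, OF _ cosh_real_pos le(2)]) simp
  then show "\<bar>x\<bar> - ln 2 \<le> ln (cosh x)"
    using ln_div[of "exp \<bar>x\<bar>" 2] by simp
qed

text \<open>
  Two changes are made to the rescaled walk: \<open>S n\<close> is replaced by \<open>ln (cosh (S n))\<close>, at distance at
  most \<open>ln 2\<close>, and the latter by a sum of \<open>n\<close> independent copies of \<open>ln (cosh X)\<close>. The second
  change is controlled by \<open>random_walk_char_error\<close> at \<open>u / sqrt n\<close>, where the total error
  depends on \<open>n\<close>, \<open>\<alpha>\<close> and \<open>\<beta>\<close> only through \<open>q\<close>, which is of order \<open>n / \<alpha>\<close>.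
\<close>

lemma (in jacobi_kernel) random_walk_char_bound:
  fixes n :: nat and m u :: real
  assumes walk: "jacobi_random_walk \<alpha> \<beta> \<nu> M S" and n: "n > 0"
  defines "q \<equiv> real n * ((\<beta> + 1) / (\<alpha> + 1))"
  shows "cmod (char (distr M borel (\<lambda>\<omega>. (S n \<omega> - real n * m) / sqrt (real n))) u -
      char (distr \<nu> borel (\<lambda>x. ln (cosh x) - m)) (u / sqrt (real n)) ^ n)
    \<le> \<bar>u\<bar> * ln 2 / sqrt (real n) + 2 * \<bar>u\<bar> * sqrt q + 8 * q"
proof -
  interpret M: prob_space M using walk by (simp add: jacobi_random_walk_def)
  have "S n \<in> M \<rightarrow>\<^sub>M restrict_space borel {0..}"
    using walk by (simp add: jacobi_random_walk_def)
  then have S [measurable]: "S n \<in> borel_measurable M" and S_nonneg: "\<And>\<omega>. \<omega> \<in> space M \<Longrightarrow> S n \<omega> \<ge> 0"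
    by (auto simp: measurable_restrict_space2_iff)
  let ?w = "u / sqrt (real n)"
  let ?f = "\<lambda>\<omega>. iexp (u * ((S n \<omega> - real n * m) / sqrt (real n)))"
  let ?g = "\<lambda>\<omega>. iexp (u * ((ln (cosh (S n \<omega>)) - real n * m) / sqrt (real n)))"
  let ?\<chi> = "\<integral>\<omega>. iexp (?w * ln (cosh (S n \<omega>))) \<partial>M"
  let ?\<psi> = "\<integral>t. iexp (?w * ln (cosh t)) \<partial>\<nu>"
  have f: "integrable M ?f" and g: "integrable M ?g"
    by (rule M.integrable_const_bound[of _ 1]; simp)+
  have "cmod ((\<integral>\<omega>. ?f \<omega> \<partial>M) - (\<integral>\<omega>. ?g \<omega> \<partial>M)) = cmod (\<integral>\<omega>. ?f \<omega> - ?g \<omega> \<partial>M)"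
    by (simp only: Bochner_Integration.integral_diff[OF f g])
  also have "\<dots> \<le> (\<integral>\<omega>. cmod (?f \<omega> - ?g \<omega>) \<partial>M)"
    by (rule integral_norm_bound)
  also have "\<dots> \<le> (\<integral>\<omega>. \<bar>u\<bar> * ln 2 / sqrt (real n) \<partial>M)"
  proof (rule integral_mono)
    show "integrable M (\<lambda>\<omega>. cmod (?f \<omega> - ?g \<omega>))"
      using f g by (intro integrable_norm Bochner_Integration.integrable_diff)
    fix \<omega> assume "\<omega> \<in> space M"
    then have d: "\<bar>S n \<omega> - ln (cosh (S n \<omega>))\<bar> \<le> ln 2"
      using ln_cosh_bounds[of "S n \<omega>"] S_nonneg[of \<omega>] by simp
    have "cmod (?f \<omega> - ?g \<omega>) \<le> \<bar>u * ((S n \<omega> - real n * m) / sqrt (real n)) -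
        u * ((ln (cosh (S n \<omega>)) - real n * m) / sqrt (real n))\<bar>"
      by (rule cmod_iexp_diff_le)
    also have "\<dots> = \<bar>?w * (S n \<omega> - ln (cosh (S n \<omega>)))\<bar>"
      by (rule arg_cong[where f = abs]) (simp add: algebra_simps diff_divide_distrib)
    also have "\<dots> = \<bar>u\<bar> * \<bar>S n \<omega> - ln (cosh (S n \<omega>))\<bar> / sqrt (real n)"
      by (simp add: abs_mult)
    also have "\<dots> \<le> \<bar>u\<bar> * ln 2 / sqrt (real n)"
      using d by (intro divide_right_mono mult_left_mono) auto
    finally show "cmod (?f \<omega> - ?g \<omega>) \<le> \<bar>u\<bar> * ln 2 / sqrt (real n)" .
  qed simp
  finally have 1: "cmod ((\<integral>\<omega>. ?f \<omega> \<partial>M) - (\<integral>\<omega>. ?g \<omega> \<partial>M)) \<le> \<bar>u\<bar> * ln 2 / sqrt (real n)"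
    using M.prob_space by simp

  let ?c = "iexp (- (?w * m)) ^ n"
  have c: "?c = iexp (- (?w * (real n * m)))"
    by (subst exp_of_nat_mult[symmetric]) (simp add: mult_ac)
  have g_eq: "(\<integral>\<omega>. ?g \<omega> \<partial>M) = ?c * ?\<chi>"
  proof -
    have "?g \<omega> = ?c * iexp (?w * ln (cosh (S n \<omega>)))" for \<omega>
      unfolding c by (simp add: diff_divide_distrib right_diff_distrib flip: exp_add)
    then show ?thesis by (simp only: integral_mult_right_zero)
  qed
  have psi_eq: "char (distr \<nu> borel (\<lambda>x. ln (cosh x) - m)) ?w ^ n = ?c * ?\<psi> ^ n"
  proof -
    have "char (distr \<nu> borel (\<lambda>x. ln (cosh x) - m)) ?w = (\<integral>x. iexp (?w * (ln (cosh x) - m)) \<partial>\<nu>)"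
      unfolding char_def by (rule integral_distr) simp_all
    also have "\<dots> = (\<integral>x. iexp (- (?w * m)) * iexp (?w * ln (cosh x)) \<partial>\<nu>)"
      by (intro Bochner_Integration.integral_cong) (simp_all add: right_diff_distrib flip: exp_add)
    also have "\<dots> = iexp (- (?w * m)) * ?\<psi>"
      by (rule integral_mult_right_zero)
    finally show ?thesis by (simp only: power_mult_distrib)
  qed
  have "cmod (?c * ?\<chi> - ?c * ?\<psi> ^ n) = cmod ?c * cmod (?\<chi> - ?\<psi> ^ n)"
    by (simp only: norm_mult flip: right_diff_distrib)
  also have "cmod ?c = 1" unfolding c by (rule norm_exp_i_times)
  also have "1 * cmod (?\<chi> - ?\<psi> ^ n) \<le>
      real n * (2 * \<bar>?w\<bar> * sqrt ((\<beta> + 1) / (\<alpha> + 1)) + 8 * ((\<beta> + 1) / (\<alpha> + 1)))"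
    unfolding mult_1 by (rule random_walk_char_error[OF walk])
  also have "\<dots> = 2 * \<bar>u\<bar> * sqrt q + 8 * q"
  proof -
    have "real n * (2 * \<bar>?w\<bar> * sqrt ((\<beta> + 1) / (\<alpha> + 1))) = 2 * \<bar>u\<bar> * (real n / sqrt (real n) * sqrt ((\<beta> + 1) / (\<alpha> + 1)))"
      by simp
    also have "\<dots> = 2 * \<bar>u\<bar> * sqrt q"
      unfolding q_def real_sqrt_mult by (simp add: real_div_sqrt)
    finally show ?thesis unfolding q_def by (simp only: distrib_left) simp
  qed
  finally have 2: "cmod ((\<integral>\<omega>. ?g \<omega> \<partial>M) - char (distr \<nu> borel (\<lambda>x. ln (cosh x) - m)) ?w ^ n) \<le> 2 * \<bar>u\<bar> * sqrt q + 8 * q"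
    unfolding g_eq psi_eq .
  have "char (distr M borel (\<lambda>\<omega>. (S n \<omega> - real n * m) / sqrt (real n))) u = (\<integral>\<omega>. ?f \<omega> \<partial>M)"
    unfolding char_def by (rule integral_distr) simp_all
  then show ?thesis
    using norm_triangle_mono[OF 1 2] by (simp only: diff_add_cancel add_diff_eq add.assoc)
qed

lemma eq_return_if_AE_eq:
  assumes "prob_space \<nu>" "sets \<nu> = sets borel" "AE x in \<nu>. x = c"
  shows "\<nu> = return borel (c :: real)"
proof -
  interpret prob_space \<nu> by fact
  have [simp]: "space \<nu> = UNIV" using sets_eq_imp_space_eq[OF assms(2)] by simp
  have "\<nu> = distr \<nu> borel (\<lambda>x. x)"
    using assms(2) by (simp add: distr_id2)
  also have "\<dots> = distr \<nu> borel (\<lambda>x. c)"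
    using assms by (intro distr_cong_AE) (simp_all cong: measurable_cong_sets)
  also have "\<dots> = return borel c" by simp
  finally show ?thesis .
qed

lemma weak_conv_m_offset:
  "weak_conv_m (\<lambda>n. \<mu> (n + k)) \<mu>' \<Longrightarrow> weak_conv_m \<mu> \<mu>'"
  unfolding weak_conv_m_def weak_conv_def by (auto intro: LIMSEQ_offset)

theorem theorem3p1:
  fixes \<beta> :: real and \<alpha> :: "nat \<Rightarrow> real" and \<nu> :: "real measure"
    and M :: "nat \<Rightarrow> 'a measure" and S :: "nat \<Rightarrow> nat \<Rightarrow> 'a \<Rightarrow> real"
    and m1 m2 :: real
  defines "m1 \<equiv> (\<integral>x. ln (cosh x) \<partial>\<nu>)"
    and "m2 \<equiv> (\<integral>x. (ln (cosh x))\<^sup>2 \<partial>\<nu>)"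
  assumes "\<beta> \<ge> -1/2"
    and "\<And>n. n \<ge> 1 \<Longrightarrow> \<alpha> n \<ge> \<beta>"
    and "\<And>n. n \<ge> 1 \<Longrightarrow> \<alpha> n > -1/2"
    and "mono_on {1..} \<alpha>"
    and "\<forall>\<^sub>F n in sequentially. \<alpha> n \<noteq> 0"
    and "(\<lambda>n. real n / \<alpha> n) \<longlonglongrightarrow> 0"
    and "prob_space \<nu>" and "sets \<nu> = sets borel" and "AE x in \<nu>. 0 \<le> x"
    and "integrable \<nu> (\<lambda>x. x\<^sup>2)"
    and "\<nu> \<noteq> return borel 0"
    and "\<And>n. n \<ge> 1 \<Longrightarrow> jacobi_random_walk (\<alpha> n) \<beta> \<nu> (M n) (S n)"
  shows "integrable \<nu> (\<lambda>x. ln (cosh x)) \<and>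
    integrable \<nu> (\<lambda>x. (ln (cosh x))\<^sup>2) \<and>
    m1\<^sup>2 \<le> m2 \<and>
    ((\<forall>c. \<nu> \<noteq> return borel c) \<longrightarrow> m1\<^sup>2 < m2) \<and>
    weak_conv_m (\<lambda>n. distr (M n) borel (\<lambda>\<omega>. (S n n \<omega> - real n * m1) / sqrt (real n)))
      (normal_law 0 (m2 - m1\<^sup>2))"
proof -
  note \<beta> = assms(3) and \<alpha>_gt = assms(5) and \<alpha>_nz = assms(7) and lim = assms(8)
    and sets_\<nu> [measurable_cong] = assms(10) and walk = assms(14)
  interpret \<nu>: prob_space \<nu> by fact
  let ?L = "\<lambda>x::real. ln (cosh x)"
  have L2: "integrable \<nu> (\<lambda>x. (?L x)\<^sup>2)"
  proof (rule Bochner_Integration.integrable_bound[OF assms(12)])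
    have "(?L x)\<^sup>2 \<le> x\<^sup>2" for x
      using ln_cosh_bounds[of x] power_mono[of "?L x" "\<bar>x\<bar>" 2] by simp
    then show "AE x in \<nu>. norm ((?L x)\<^sup>2) \<le> norm (x\<^sup>2)" by simp
  qed simp
  then have L1: "integrable \<nu> ?L"
    by (rule \<nu>.square_integrable_imp_integrable[rotated]) simp
  have var: "\<nu>.variance ?L = m2 - m1\<^sup>2"
    using \<nu>.variance_eq[OF L1 L2] by (simp add: m1_def m2_def)
  have v: "m1\<^sup>2 \<le> m2"
    using \<nu>.variance_positive[of ?L] var by simp
  \<comment> \<open>If the variance vanishes, \<open>ln (cosh x)\<close> is almost surely constant, and it is injective on
    \<open>[0, \<infinity>[\<close>.\<close>
  have "\<exists>c. \<nu> = return borel c" if "m2 - m1\<^sup>2 = 0"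
  proof -
    have "integrable \<nu> (\<lambda>x. (?L x - m1)\<^sup>2)"
      using L1 L2 by (simp add: power2_diff)
    then have "AE x in \<nu>. (?L x - m1)\<^sup>2 = 0"
      using var that by (subst integral_nonneg_eq_0_iff_AE[symmetric]) (simp_all add: m1_def)
    with assms(11) have "AE x in \<nu>. x = arcosh (exp m1)"
    proof eventually_elim
      case (elim x)
      then have "m1 = ln (cosh x)" by simp
      then have "exp m1 = cosh x" by (simp add: cosh_real_pos)
      then show ?case using elim by (simp add: arcosh_cosh_real)
    qed
    then show ?thesis using eq_return_if_AE_eq[OF assms(9,10)] by blast
  qed
  then have "m2 - m1\<^sup>2 \<noteq> 0" if "\<forall>c. \<nu> \<noteq> return borel c"
    using that by blast
  with v have strict: "(\<forall>c. \<nu> \<noteq> return borel c) \<longrightarrow> m1\<^sup>2 < m2"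
    by (auto simp: less_le)

  let ?T = "\<lambda>n \<omega>. (S n n \<omega> - real n * m1) / sqrt (real n)"
  let ?\<mu> = "\<lambda>n. distr (M n) borel (?T n)"
  let ?X = "distr \<nu> borel (\<lambda>x. ?L x - m1)"
  \<comment> \<open>As \<open>\<alpha> n\<close> is bounded below and not \<open>0\<close>, the limit of \<open>n / \<alpha> n\<close> forces \<open>\<alpha> n > n\<close> eventually. So the
    boundary case \<open>\<alpha> = \<beta>\<close>, in which \<open>r = 1\<close>, does not occur for large \<open>n\<close>.\<close>
  have "\<forall>\<^sub>F n in sequentially. n \<ge> 1 \<and> \<alpha> n > \<beta> \<and> \<alpha> n > 0"
  proof -
    have "\<forall>\<^sub>F n in sequentially. \<bar>real n / \<alpha> n\<bar> < 1"
      using order_tendstoD(2)[OF tendsto_rabs[OF lim], of 1] by simp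
    moreover have "\<forall>\<^sub>F n in sequentially. n \<ge> max 1 (nat \<lceil>\<beta>\<rceil>)"
      by (rule eventually_ge_at_top)
    ultimately show ?thesis using \<alpha>_nz
    proof eventually_elim
      case (elim n)
      then have "real n < \<bar>\<alpha> n\<bar>" by (simp add: abs_divide divide_less_eq)
      moreover have "n \<ge> 1" "real n \<ge> \<beta>" using elim by (auto simp: nat_ceiling_le_eq)
      ultimately show ?case using \<alpha>_gt[of n] by (auto simp: abs_if split: if_splits)
    qed
  qed
  then obtain N where N: "\<And>n. n \<ge> N \<Longrightarrow> n \<ge> 1 \<and> \<alpha> n > \<beta> \<and> \<alpha> n > 0"
    by (auto simp: eventually_sequentially)
  have distr: "real_distribution (?\<mu> n)" if "n \<ge> N" for n
  proof -
    have "prob_space (M n)" "S n n \<in> borel_measurable (M n)"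
      using walk[of n] N[OF that] by (auto simp: jacobi_random_walk_def measurable_restrict_space2_iff)
    then show ?thesis by (intro prob_space.real_distribution_distr) simp_all
  qed
  have char_lim: "(\<lambda>n. char (?\<mu> n) u) \<longlonglongrightarrow> char (normal_law 0 (m2 - m1\<^sup>2)) u" for u
  proof -
    let ?q = "\<lambda>n. real n * ((\<beta> + 1) / (\<alpha> n + 1))"
    let ?Y = "\<lambda>n. char ?X (u / sqrt (real n)) ^ n"
    have bound: "cmod (char (?\<mu> n) u - ?Y n) \<le> \<bar>u\<bar> * ln 2 / sqrt (real n) + 2 * \<bar>u\<bar> * sqrt (?q n) + 8 * ?q n"
      if "n \<ge> N" for n
    proof -
      interpret jacobi_kernel "\<alpha> n" \<beta> \<nu>
        using N[OF that] \<beta> sets_\<nu> by unfold_locales auto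
      show ?thesis
        using N[OF that] by (intro random_walk_char_bound walk) simp_all
    qed
    have q: "?q \<longlonglongrightarrow> 0"
    proof (rule tendsto_sandwich[of "\<lambda>n. 0" _ _ "\<lambda>n. (\<beta> + 1) * (real n / \<alpha> n)"])
      show "\<forall>\<^sub>F n in sequentially. 0 \<le> ?q n"
      proof (rule eventually_sequentiallyI[of N])
        fix n assume "N \<le> n"
        then show "0 \<le> ?q n"
          using N[of n] \<beta> by (intro mult_nonneg_nonneg divide_nonneg_pos) auto
      qed
      show "\<forall>\<^sub>F n in sequentially. ?q n \<le> (\<beta> + 1) * (real n / \<alpha> n)"
      proof (rule eventually_sequentiallyI[of N])
        fix n assume "N \<le> n"
        then have "real n / (\<alpha> n + 1) \<le> real n / \<alpha> n"
          using N[of n] by (intro divide_left_mono) auto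
        then have "(\<beta> + 1) * (real n / (\<alpha> n + 1)) \<le> (\<beta> + 1) * (real n / \<alpha> n)"
          using \<beta> by (intro mult_left_mono) auto
        then show "?q n \<le> (\<beta> + 1) * (real n / \<alpha> n)" by (simp add: mult.commute)
      qed
    qed (use tendsto_mult_right_zero[OF lim] in simp_all)
    have "(\<lambda>n. \<bar>u\<bar> * ln 2 / sqrt (real n)) \<longlonglongrightarrow> 0"
      by (intro tendsto_divide_0[OF tendsto_const] filterlim_at_top_imp_at_infinity
         filterlim_compose[OF sqrt_at_top filterlim_real_sequentially])
    moreover have "(\<lambda>n. 2 * \<bar>u\<bar> * sqrt (?q n)) \<longlonglongrightarrow> 0"
      using tendsto_mult_right_zero[OF tendsto_real_sqrt[OF q, simplified real_sqrt_zero], of "2 * \<bar>u\<bar>"] .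
    moreover have "(\<lambda>n. 8 * ?q n) \<longlonglongrightarrow> 0"
      by (rule tendsto_mult_right_zero[OF q])
    ultimately have "(\<lambda>n. \<bar>u\<bar> * ln 2 / sqrt (real n) + 2 * \<bar>u\<bar> * sqrt (?q n) + 8 * ?q n) \<longlonglongrightarrow> 0"
      by (intro tendsto_add_zero)
    moreover have "\<forall>\<^sub>F n in sequentially. cmod (char (?\<mu> n) u - ?Y n) \<le>
        \<bar>u\<bar> * ln 2 / sqrt (real n) + 2 * \<bar>u\<bar> * sqrt (?q n) + 8 * ?q n"
      using bound by (rule eventually_sequentiallyI)
    ultimately have diff: "(\<lambda>n. char (?\<mu> n) u - ?Y n) \<longlonglongrightarrow> 0"
      by (rule Lim_null_comparison[rotated])
    interpret X: real_distribution ?X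
      by (rule \<nu>.real_distribution_distr) simp
    have "?Y \<longlonglongrightarrow> complex_of_real (exp (- (u\<^sup>2 * (m2 - m1\<^sup>2)) / 2))"
    proof (rule X.char_power_tendsto)
      show "integrable ?X (\<lambda>x. x)" "integrable ?X (\<lambda>x. x\<^sup>2)"
        using L1 L2 by (simp_all add: integrable_distr_eq power2_diff)
      show "(\<integral>x. x \<partial>?X) = 0"
        using L1 \<nu>.prob_space by (simp add: integral_distr m1_def)
      show "(\<integral>x. x\<^sup>2 \<partial>?X) = m2 - m1\<^sup>2"
        using var by (simp add: integral_distr m1_def)
    qed
    from tendsto_add[OF diff this] show ?thesis
      using v by (simp add: char_normal_law)
  qed
  have "weak_conv_m ?\<mu> (normal_law 0 (m2 - m1\<^sup>2))"
  proof (rule weak_conv_m_offset[of _ N], rule levy_continuity)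
    show "real_distribution (normal_law 0 (m2 - m1\<^sup>2))"
      using v by (intro real_distribution_normal_law) simp
    show "(\<lambda>n. char (?\<mu> (n + N)) u) \<longlonglongrightarrow> char (normal_law 0 (m2 - m1\<^sup>2)) u" for u
      using char_lim[of u] by (rule LIMSEQ_ignore_initial_segment)
    show "real_distribution (?\<mu> (n + N))" for n
      by (rule distr) simp
  qed
  with L1 L2 v strict show ?thesis by blast
qed

end
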